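(* Let $H$ be a Hopf algebra and $\delta$ a character on $H$. For $n\ge 0$ put $H^{\sharp}_{\delta}[n]=H^{\otimes n}$ (with $H^{\otimes 0}=\mathbb{C}$) and consider the maps $$d_\delta^{0}(h^1,\dots,h^n)=(1,h^1,\dots,h^n),\qquad d_\delta^{i}(h^1,\dots,h^n)=(h^1,\dots,h^{i-1},\Delta h^i,h^{i+1},\dots,h^n)\ (1\le i\le n),$$ $$d_\delta^{n+1}(h^1,\dots,h^n)=(h^1,\dots,h^n,1),$$ $$s_\delta^{i}(h^1,\dots,h^n)=(h^1,\dots,\epsilon(h^{i+1}),\dots,h^n)\quad (0\le i\le n-1),$$ $$t_\delta(h^1,\dots,h^n)=S_\delta(h^1)\cdot(h^2,\dots,h^n,1).$$ These formulas make $H^{\sharp}_{\delta}$ into a cyclic module if and only if $S_\delta^2=\mathrm{Id}$. More precisely, on $H^{\otimes n}$ one has $$t_\delta^{\,n+1}(h^1,h^2,\dots,h^n)=(S_\delta^2(h^1),\dots,S_\delta^2(h^n)).$$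
   Context: $H$ is a Hopf algebra over $\mathbb{C}$ with counit $\epsilon$, antipode $S$ and coproduct $\Delta(h)=\sum h_0\otimes h_1$. A character $\delta$ is a non-zero algebra map $H\to\mathbb{C}$; the twisted antipode is $S_\delta(h)=\sum\delta(h_0)S(h_1)$. The dot $\cdot$ denotes the diagonal action of $H$ on $H^{\otimes n}$: $g\cdot(h^1,\dots,h^n)=\sum (g_{(1)}h^1,\dots,g_{(n)}h^n)$, where $\sum g_{(1)}\otimes\dots\otimes g_{(n)}$ is the iterated coproduct of $g$. $(h^1,\dots,h^n)$ stands for $h^1\otimes\dots\otimes h^n$. "Cyclic module" means a module over Connes' cyclic category $\Lambda$ in the cosimplicial convention (a cocyclic vector space): the $d^i$ are the cofaces $H^{\otimes n}\to H^{\otimes(n+1)}$, the $s^i$ the codegeneracies $H^{\otimes n}\to H^{\otimes(n-1)}$, and $t$ on degree $n$ is the cyclic operator, required to satisfy in particular $t^{n+1}=1$. *)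

theory Defs
  imports Complex_Main "HOL-Library.Poly_Mapping"
begin

section \<open>Complex vector spaces and unital complex algebras\<close>

class complex_vector = ab_group_add +
  fixes scaleC :: "complex \<Rightarrow> 'a \<Rightarrow> 'a" (infixr "*\<^sub>C" 75)
  assumes scaleC_add_right: "c *\<^sub>C (x + y) = c *\<^sub>C x + c *\<^sub>C y"
    and scaleC_add_left: "(c + c') *\<^sub>C x = c *\<^sub>C x + c' *\<^sub>C x"
    and scaleC_scaleC: "c *\<^sub>C c' *\<^sub>C x = (c * c') *\<^sub>C x"
    and scaleC_one: "1 *\<^sub>C x = x"

text \<open>The requirement \<open>0 \<noteq> 1\<close> contained in \<^class>\<open>ring_1\<close> excludes no Hopf algebra, since a counit
  satisfies \<open>\<epsilon> 1 = 1\<close>.\<close>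

class complex_algebra_1 = complex_vector + ring_1 +
  assumes mult_scaleC_left: "(c *\<^sub>C x) * y = c *\<^sub>C (x * y)"
    and mult_scaleC_right: "x * (c *\<^sub>C y) = c *\<^sub>C (x * y)"

global_interpretation cvec: vector_space "scaleC :: complex \<Rightarrow> 'a \<Rightarrow> 'a::complex_vector"
  by standard (simp_all add: scaleC_add_right scaleC_add_left scaleC_scaleC scaleC_one)

abbreviation clinear :: "('a::complex_vector \<Rightarrow> 'b::complex_vector) \<Rightarrow> bool"
  where "clinear \<equiv> Vector_Spaces.linear scaleC scaleC"

lemma clinearI:
  assumes "\<And>x y. f (x + y) = f x + f y" and "\<And>c x. f (c *\<^sub>C x) = c *\<^sub>C f x"
  shows "clinear f"
  by unfold_locales (simp_all add: assms)

lemma clinear_add: "clinear f \<Longrightarrow> f (x + y) = f x + f y"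
  by (simp add: Vector_Spaces.linear_iff)

lemma clinear_scale: "clinear f \<Longrightarrow> f (c *\<^sub>C x) = c *\<^sub>C f x"
  by (simp add: Vector_Spaces.linear_iff)

lemma clinear_zero: "clinear f \<Longrightarrow> f 0 = 0"
  using clinear_add[of f 0 0] by simp

lemma clinear_diff: "clinear f \<Longrightarrow> f (x - y) = f x - f y"
  using clinear_add[of f "x - y" y] by (simp add: algebra_simps)

instantiation complex :: complex_algebra_1
begin
definition scaleC_complex :: "complex \<Rightarrow> complex \<Rightarrow> complex" where
  "scaleC_complex c x = c * x"
instance
  by standard (simp_all add: scaleC_complex_def algebra_simps)
end

instantiation poly_mapping :: (type, complex_vector) complex_vector
begin
lift_definition scaleC_poly_mapping :: "complex \<Rightarrow> ('a \<Rightarrow>\<^sub>0 'b) \<Rightarrow> 'a \<Rightarrow>\<^sub>0 'b"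
  is "\<lambda>c f x. c *\<^sub>C f x"
  by (rule finite_subset[rotated]) auto
instance
  by (standard; transfer) (simp_all add: scaleC_add_right scaleC_add_left scaleC_scaleC scaleC_one)
end

lemma lookup_scaleC: "Poly_Mapping.lookup (c *\<^sub>C p) x = c *\<^sub>C Poly_Mapping.lookup p x"
  by (simp add: scaleC_poly_mapping.rep_eq)


section \<open>Tensor powers\<close>

text \<open>All tensor powers of \<open>V\<close> are collected in one type, the tensor algebra
  \<open>\<Oplus>n. V\<^bsup>\<otimes>n\<^esup>\<close>: the free vector space on the lists over \<open>V\<close> modulo multilinearity in each
  entry. The relations are homogeneous in the length, so the \<open>n\<close>-th tensor power is the span of
  the classes of the lists of length \<open>n\<close>; for \<open>n = 0\<close> this is the line spanned by the class of the
  empty list.\<close>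

definition tensor_relators :: "('a::complex_vector list \<Rightarrow>\<^sub>0 complex) set" where
  "tensor_relators =
     {Poly_Mapping.single (xs @ (a + b) # ys) 1 - Poly_Mapping.single (xs @ a # ys) 1
        - Poly_Mapping.single (xs @ b # ys) 1 | xs a b ys. True}
   \<union> {Poly_Mapping.single (xs @ (c *\<^sub>C a) # ys) 1 - Poly_Mapping.single (xs @ a # ys) c
        | xs c a ys. True}"

definition tensor_rel ::
  "('a::complex_vector list \<Rightarrow>\<^sub>0 complex) \<Rightarrow> ('a list \<Rightarrow>\<^sub>0 complex) \<Rightarrow> bool" where
  "tensor_rel p q \<longleftrightarrow> p - q \<in> cvec.span tensor_relators"

lemma equivp_tensor_rel: "equivp (tensor_rel :: ('a::complex_vector list \<Rightarrow>\<^sub>0 complex) \<Rightarrow> _)"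
proof (rule equivpI)
  show "reflp (tensor_rel :: ('a list \<Rightarrow>\<^sub>0 complex) \<Rightarrow> _)"
    by (simp add: reflp_def tensor_rel_def cvec.span_zero)
  show "symp (tensor_rel :: ('a list \<Rightarrow>\<^sub>0 complex) \<Rightarrow> _)"
    unfolding symp_def tensor_rel_def by (metis cvec.span_neg minus_diff_eq)
  show "transp (tensor_rel :: ('a list \<Rightarrow>\<^sub>0 complex) \<Rightarrow> _)"
  proof (rule transpI)
    fix p q r :: "'a list \<Rightarrow>\<^sub>0 complex"
    assume "tensor_rel p q" "tensor_rel q r"
    then have "(p - q) + (q - r) \<in> cvec.span tensor_relators"
      unfolding tensor_rel_def by (rule cvec.span_add)
    then show "tensor_rel p r"
      by (simp add: tensor_rel_def)
  qed
qed

quotient_type (overloaded) 'a tensor = "'a::complex_vector list \<Rightarrow>\<^sub>0 complex" / tensor_rel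
  by (rule equivp_tensor_rel)

instantiation tensor :: (complex_vector) complex_vector
begin

lift_definition zero_tensor :: "'a tensor" is 0 .

lift_definition plus_tensor :: "'a tensor \<Rightarrow> 'a tensor \<Rightarrow> 'a tensor" is "(+)"
  unfolding tensor_rel_def by (simp only: add_diff_add cvec.span_add)

lift_definition uminus_tensor :: "'a tensor \<Rightarrow> 'a tensor" is uminus
  unfolding tensor_rel_def by (metis cvec.span_neg minus_diff_minus)

lift_definition minus_tensor :: "'a tensor \<Rightarrow> 'a tensor \<Rightarrow> 'a tensor" is "(-)"
proof -
  fix p p' q q' :: "'a list \<Rightarrow>\<^sub>0 complex"
  assume "tensor_rel p p'" "tensor_rel q q'"
  then have "(p - p') - (q - q') \<in> cvec.span tensor_relators"
    unfolding tensor_rel_def by (rule cvec.span_diff)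
  also have "(p - p') - (q - q') = (p - q) - (p' - q')"
    by (simp add: algebra_simps)
  finally show "tensor_rel (p - q) (p' - q')"
    by (simp add: tensor_rel_def)
qed

lift_definition scaleC_tensor :: "complex \<Rightarrow> 'a tensor \<Rightarrow> 'a tensor" is scaleC
  unfolding tensor_rel_def by (simp only: cvec.scale_right_diff_distrib[symmetric] cvec.span_scale)

instance
proof
  fix x y z :: "'a tensor" and c c' :: complex
  have refl: "tensor_rel p p" for p :: "'a list \<Rightarrow>\<^sub>0 complex"
    using equivp_tensor_rel by (rule equivp_reflp)
  show "x + y + z = x + (y + z)" by transfer (simp add: add.assoc refl)
  show "x + y = y + x" by transfer (simp add: add.commute refl)
  show "0 + x = x" by transfer (simp add: refl)
  show "- x + x = 0" by transfer (simp add: refl)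
  show "x - y = x + - y" by transfer (simp add: refl)
  show "c *\<^sub>C (x + y) = c *\<^sub>C x + c *\<^sub>C y" by transfer (simp add: scaleC_add_right refl)
  show "(c + c') *\<^sub>C x = c *\<^sub>C x + c' *\<^sub>C x" by transfer (simp add: scaleC_add_left refl)
  show "c *\<^sub>C c' *\<^sub>C x = (c * c') *\<^sub>C x" by transfer (simp add: scaleC_scaleC refl)
  show "1 *\<^sub>C x = x" by transfer (simp add: scaleC_one refl)
qed

end

text \<open>\<open>tens [h\<^sub>1, \<dots>, h\<^sub>n]\<close> is the pure tensor \<open>h\<^sub>1 \<otimes> \<dots> \<otimes> h\<^sub>n\<close>.\<close>

lift_definition tens :: "'a::complex_vector list \<Rightarrow> 'a tensor"
  is "\<lambda>xs. Poly_Mapping.single xs 1" .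

definition tensor_power :: "nat \<Rightarrow> 'a::complex_vector tensor set" where
  "tensor_power n = cvec.span {tens xs | xs. length xs = n}"

definition multilinear :: "('a::complex_vector list \<Rightarrow> 'b::complex_vector) \<Rightarrow> bool" where
  "multilinear f \<longleftrightarrow> (\<forall>xs ys. clinear (\<lambda>a. f (xs @ a # ys)))"

text \<open>The linear map induced by a map on lists that is multilinear on each length (unspecified for
  other maps).\<close>

definition tensor_extend ::
  "('a::complex_vector list \<Rightarrow> 'b::complex_vector) \<Rightarrow> 'a tensor \<Rightarrow> 'b" where
  "tensor_extend f = (THE g. clinear g \<and> (\<forall>xs. g (tens xs) = f xs))"

lemma multilinear_tens: "multilinear (tens :: 'a::complex_vector list \<Rightarrow> _)"
  unfolding multilinear_def
proof (intro allI clinearI)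
  fix xs ys :: "'a list" and a b and c :: complex
  show "tens (xs @ (a + b) # ys) = tens (xs @ a # ys) + tens (xs @ b # ys)"
  proof transfer
    fix xs ys :: "'a list" and a b
    have "Poly_Mapping.single (xs @ (a + b) # ys) (1::complex) - Poly_Mapping.single (xs @ a # ys) 1
        - Poly_Mapping.single (xs @ b # ys) 1 \<in> cvec.span tensor_relators"
      by (rule cvec.span_base) (unfold tensor_relators_def, blast)
    then show "tensor_rel (Poly_Mapping.single (xs @ (a + b) # ys) 1)
        (Poly_Mapping.single (xs @ a # ys) 1 + Poly_Mapping.single (xs @ b # ys) 1)"
      by (simp add: tensor_rel_def diff_diff_add)
  qed
  show "tens (xs @ (c *\<^sub>C a) # ys) = c *\<^sub>C tens (xs @ a # ys)"
  proof transfer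
    fix xs ys :: "'a list" and a and c :: complex
    have *: "c *\<^sub>C Poly_Mapping.single (xs @ a # ys) (1::complex)
        = Poly_Mapping.single (xs @ a # ys) c"
      by (rule poly_mapping_eqI) (simp add: lookup_scaleC lookup_single when_def scaleC_complex_def)
    have "Poly_Mapping.single (xs @ (c *\<^sub>C a) # ys) (1::complex) - Poly_Mapping.single (xs @ a # ys) c
        \<in> cvec.span tensor_relators"
      by (rule cvec.span_base) (unfold tensor_relators_def, blast)
    then show "tensor_rel (Poly_Mapping.single (xs @ (c *\<^sub>C a) # ys) 1)
        (c *\<^sub>C Poly_Mapping.single (xs @ a # ys) 1)"
      by (simp add: tensor_rel_def *)
  qed
qed

lemma poly_mapping_sum_singles:
  "p = (\<Sum>x\<in>Poly_Mapping.keys p. Poly_Mapping.lookup p x *\<^sub>C Poly_Mapping.single x (1::complex))"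
  by (rule poly_mapping_eqI)
    (auto simp: lookup_sum lookup_scaleC lookup_single when_def scaleC_complex_def in_keys_iff
      if_distrib sum.delta cong: if_cong)

lemma span_tens: "cvec.span (range tens) = (UNIV :: 'a::complex_vector tensor set)"
proof (intro set_eqI iffI UNIV_I)
  fix T :: "'a tensor"
  obtain p where T: "T = abs_tensor p"
    by (metis Quotient3_abs_rep Quotient3_tensor)
  have add: "abs_tensor (q + r) = abs_tensor q + abs_tensor r" for q r :: "'a list \<Rightarrow>\<^sub>0 complex"
    by (simp add: plus_tensor.abs_eq)
  have "abs_tensor (\<Sum>x\<in>A. c x *\<^sub>C Poly_Mapping.single x (1::complex)) \<in> cvec.span (range tens)"
    if "finite A" for A :: "'a list set" and c
    using that
  proof induction
    case empty
    then show ?case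
      by (simp add: zero_tensor.abs_eq[symmetric] cvec.span_zero)
  next
    case (insert x A)
    have "abs_tensor (c x *\<^sub>C Poly_Mapping.single x 1) = c x *\<^sub>C tens x"
      by (simp add: scaleC_tensor.abs_eq tens.abs_eq)
    then show ?case
      using insert by (simp add: add cvec.span_add cvec.span_scale cvec.span_base)
  qed
  from this[OF finite_keys[of p], of "Poly_Mapping.lookup p"]
  show "T \<in> cvec.span (range tens)"
    by (simp only: T poly_mapping_sum_singles[symmetric])
qed

lemma clinear_tensor_eqI:
  fixes f g :: "'a::complex_vector tensor \<Rightarrow> 'b::complex_vector"
  assumes "clinear f" "clinear g" and "\<And>xs. f (tens xs) = g (tens xs)"
  shows "f = g"
proof
  fix T :: "'a tensor"
  have "T \<in> cvec.span (range tens)"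
    by (simp add: span_tens)
  then show "f T = g T"
  proof (induction rule: cvec.span_induct_alt)
    case base
    then show ?case
      by (simp add: assms clinear_zero)
  next
    case (step c x y)
    then show ?case
      using assms by (auto simp: clinear_add clinear_scale)
  qed
qed

lemma tensor_universal:
  fixes f :: "'a::complex_vector list \<Rightarrow> 'b::complex_vector"
  assumes f: "multilinear f"
  shows "\<exists>!g. clinear g \<and> (\<forall>xs. g (tens xs) = f xs)"
proof -
  define F where
    "F p = (\<Sum>x\<in>Poly_Mapping.keys p. Poly_Mapping.lookup p x *\<^sub>C f x)" for p :: "'a list \<Rightarrow>\<^sub>0 complex"
  have F_sup: "F p = (\<Sum>x\<in>A. Poly_Mapping.lookup p x *\<^sub>C f x)"
    if "finite A" "Poly_Mapping.keys p \<subseteq> A" for p A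
    unfolding F_def using that
    by (intro sum.mono_neutral_left) (auto simp: in_keys_iff)
  have F_add: "F (p + q) = F p + F q" for p q
    using keys_add[of p q]
    by (simp add: F_sup[of "Poly_Mapping.keys p \<union> Poly_Mapping.keys q"] lookup_add
        scaleC_add_left sum.distrib)
  have F_scale: "F (c *\<^sub>C p) = c *\<^sub>C F p" for c p
    using F_sup[of "Poly_Mapping.keys p" "c *\<^sub>C p"] F_sup[of "Poly_Mapping.keys p" p]
    by (force simp: lookup_scaleC cvec.scale_sum_right scaleC_scaleC scaleC_complex_def in_keys_iff)
  have linF: "clinear F"
    by (intro clinearI F_add F_scale)
  have F_single: "F (Poly_Mapping.single xs c) = c *\<^sub>C f xs" for xs c
    by (simp add: F_sup[of "{xs}"])
  have F_rel: "F r = 0" if "r \<in> tensor_relators" for r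
  proof -
    have "f (xs @ (a + b) # ys) = f (xs @ a # ys) + f (xs @ b # ys)"
      and "f (xs @ (c *\<^sub>C a) # ys) = c *\<^sub>C f (xs @ a # ys)" for xs ys a b c
      using f clinear_add[of "\<lambda>a. f (xs @ a # ys)"] clinear_scale[of "\<lambda>a. f (xs @ a # ys)"]
      by (auto simp: multilinear_def)
    then show ?thesis
      using that by (auto simp: tensor_relators_def clinear_diff[OF linF] F_single scaleC_one)
  qed
  have F_span: "F r = 0" if "r \<in> cvec.span tensor_relators" for r
    using that
    by (induction rule: cvec.span_induct_alt) (simp_all add: F_add F_scale F_rel clinear_zero[OF linF])
  have F_cong: "F p = F q" if "tensor_rel p q" for p q
    using F_span[of "p - q"] that by (simp add: tensor_rel_def clinear_diff[OF linF])
  define g where "g T = F (rep_tensor T)" for T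
  have g_abs: "g (abs_tensor p) = F p" for p
    unfolding g_def
    by (rule F_cong) (metis Quotient3_rep_abs Quotient3_tensor equivp_reflp equivp_tensor_rel)
  have abs_ex: "\<exists>p. T = abs_tensor p" for T :: "'a tensor"
    by (metis Quotient3_abs_rep Quotient3_tensor)
  have "clinear g"
  proof (rule clinearI)
    fix x y :: "'a tensor" and c
    obtain p q where "x = abs_tensor p" "y = abs_tensor q"
      using abs_ex by metis
    then show "g (x + y) = g x + g y" "g (c *\<^sub>C x) = c *\<^sub>C g x"
      by (simp_all add: plus_tensor.abs_eq scaleC_tensor.abs_eq g_abs F_add F_scale)
  qed
  moreover have "g (tens xs) = f xs" for xs
    by (simp add: tens.abs_eq g_abs F_single scaleC_one)
  ultimately show ?thesis
    by (metis (mono_tags, lifting) clinear_tensor_eqI)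
qed

lemma
  assumes "multilinear f"
  shows clinear_tensor_extend: "clinear (tensor_extend f)"
    and tensor_extend_tens: "tensor_extend f (tens xs) = f xs"
  using theI'[OF tensor_universal[OF assms]] by (auto simp: tensor_extend_def)


lemma clinear_compose: "clinear f \<Longrightarrow> clinear g \<Longrightarrow> clinear (\<lambda>x. f (g x))"
  by (rule clinearI) (simp_all add: clinear_add clinear_scale)

lemma clinear_const_zero: "clinear (\<lambda>x. 0)"
  by (rule clinearI) simp_all

lemma clinear_tensor_extend_param:
  assumes "\<And>a. multilinear (F a)" and "\<And>ys. clinear (\<lambda>a. F a ys)"
  shows "clinear (\<lambda>a. tensor_extend (F a) U)"
proof (rule clinearI)
  note [simp] = assms(1) tensor_extend_tens clinear_add[OF clinear_tensor_extend]
    clinear_scale[OF clinear_tensor_extend]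
  fix a b c
  have "tensor_extend (F (a + b)) = (\<lambda>U. tensor_extend (F a) U + tensor_extend (F b) U)"
    by (rule clinear_tensor_eqI)
      (simp_all add: clinear_add[OF assms(2)] clinear_tensor_extend clinearI scaleC_add_right)
  then show "tensor_extend (F (a + b)) U = tensor_extend (F a) U + tensor_extend (F b) U"
    by simp
  have "tensor_extend (F (c *\<^sub>C a)) = (\<lambda>U. c *\<^sub>C tensor_extend (F a) U)"
    by (rule clinear_tensor_eqI)
      (simp_all add: clinear_scale[OF assms(2)] clinear_tensor_extend clinearI scaleC_add_right
        scaleC_scaleC mult.commute)
  then show "tensor_extend (F (c *\<^sub>C a)) U = c *\<^sub>C tensor_extend (F a) U"
    by simp
qed

lemma multilinear_guard:
  assumes "\<And>xs ys. length xs + length ys + 1 = n \<Longrightarrow> clinear (\<lambda>a. f (xs @ a # ys))"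
  shows "multilinear (\<lambda>xs. if length xs = n then f xs else 0)"
  unfolding multilinear_def
proof (intro allI)
  fix xs ys :: "'a list"
  show "clinear (\<lambda>a. if length (xs @ a # ys) = n then f (xs @ a # ys) else 0)"
    using assms[of xs ys] clinear_const_zero by (cases "length xs + length ys + 1 = n") auto
qed

lemma clinear_tens: "clinear (\<lambda>a. tens (xs @ a # ys))"
  by (rule multilinear_tens[unfolded multilinear_def, rule_format])


section \<open>Operations on tensors\<close>

text \<open>The concatenation product \<open>H\<^bsup>\<otimes>m\<^esup> \<times> H\<^bsup>\<otimes>n\<^esup> \<rightarrow> H\<^bsup>\<otimes>(m+n)\<^esup>\<close>.\<close>

definition tensor_append ::
  "'a::complex_vector tensor \<Rightarrow> 'a tensor \<Rightarrow> 'a tensor" (infixr "\<otimes>" 70) where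
  "T \<otimes> U = tensor_extend (\<lambda>xs. tensor_extend (\<lambda>ys. tens (xs @ ys)) U) T"

text \<open>The product of the algebra \<open>H\<^bsup>\<otimes>n\<^esup>\<close>,
  \<open>(g\<^sub>1 \<otimes> \<dots> \<otimes> g\<^sub>n) (h\<^sub>1 \<otimes> \<dots> \<otimes> h\<^sub>n) = g\<^sub>1 h\<^sub>1 \<otimes> \<dots> \<otimes> g\<^sub>n h\<^sub>n\<close>; tensors of different degrees multiply to zero.\<close>

definition tensor_mult ::
  "'a::complex_algebra_1 tensor \<Rightarrow> 'a tensor \<Rightarrow> 'a tensor" (infixl "\<odot>" 70) where
  "T \<odot> U = tensor_extend (\<lambda>xs. tensor_extend
     (\<lambda>ys. if length xs = length ys then tens (map2 (*) xs ys) else 0) U) T"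

text \<open>\<open>sweedler f (\<Sum> h\<^sub>0 \<otimes> h\<^sub>1) = \<Sum> f h\<^sub>0 h\<^sub>1\<close> for bilinear \<open>f\<close>.\<close>

definition sweedler ::
  "('a::complex_vector \<Rightarrow> 'a \<Rightarrow> 'b::complex_vector) \<Rightarrow> 'a tensor \<Rightarrow> 'b" where
  "sweedler f = tensor_extend (\<lambda>xs. if length xs = 2 then f (xs ! 0) (xs ! 1) else 0)"

lemma multilinear_append: "multilinear (\<lambda>ys. tens (xs @ ys))"
  unfolding multilinear_def
proof (intro allI)
  show "clinear (\<lambda>a. tens (xs @ us @ a # vs))" for us vs
    using clinear_tens[of "xs @ us" vs] by simp
qed

lemma multilinear_append_left: "multilinear (\<lambda>xs. tensor_extend (\<lambda>ys. tens (xs @ ys)) U)"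
  unfolding multilinear_def
proof (intro allI clinear_tensor_extend_param multilinear_append)
  show "clinear (\<lambda>a. tens ((xs @ a # zs) @ ys))" for xs zs ys :: "'a list"
    using clinear_tens[of xs "zs @ ys"] by simp
qed

lemma tensor_append_tens: "tens xs \<otimes> tens ys = tens (xs @ ys)"
  unfolding tensor_append_def
  by (subst tensor_extend_tens[OF multilinear_append_left])
    (rule tensor_extend_tens[OF multilinear_append])

lemma clinear_append_left: "clinear (\<lambda>T. T \<otimes> U)"
  unfolding tensor_append_def by (rule clinear_tensor_extend[OF multilinear_append_left])

lemma clinear_append_right: "clinear (\<lambda>U. T \<otimes> U)"
proof -
  have *: "T \<otimes> U = tensor_extend (\<lambda>xs. tensor_extend (\<lambda>ys. tens (xs @ ys)) U) T" for U
    by (simp add: tensor_append_def)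
  show ?thesis
    unfolding *
    by (intro clinear_tensor_extend_param multilinear_append_left clinear_tensor_extend
        multilinear_append)
qed

lemma clinear_map2:
  assumes "length xs + length ys + 1 = length zs"
  shows "clinear (\<lambda>a. tens (map2 (*) (xs @ a # ys) (zs :: 'a::complex_algebra_1 list)))"
    and "clinear (\<lambda>a. tens (map2 (*) zs (xs @ a # ys)))"
proof -
  obtain z us vs where zs: "zs = us @ z # vs" "length us = length xs"
    using assms by (metis Suc_eq_plus1 add_Suc_right id_take_nth_drop le_add1 length_take less_Suc_eq_le
        min.absorb2 nat_less_le)
  have "clinear (\<lambda>a. a * z)" "clinear (\<lambda>a. z * a)"
    by (rule clinearI; simp add: algebra_simps mult_scaleC_left mult_scaleC_right)+
  from this[THEN clinear_compose[OF clinear_tens]] zs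
  show "clinear (\<lambda>a. tens (map2 (*) (xs @ a # ys) zs))" "clinear (\<lambda>a. tens (map2 (*) zs (xs @ a # ys)))"
    by simp_all
qed

lemma multilinear_mult:
  fixes xs :: "'a::complex_algebra_1 list"
  shows "multilinear (\<lambda>ys. if length xs = length ys then tens (map2 (*) xs ys) else 0)"
proof -
  have "multilinear (\<lambda>ys. if length ys = length xs then tens (map2 (*) xs ys) else 0)"
    by (rule multilinear_guard) (rule clinear_map2(2))
  then show ?thesis
    by (simp only: eq_commute)
qed

lemma multilinear_mult_left:
  fixes U :: "'a::complex_algebra_1 tensor"
  shows "multilinear (\<lambda>xs. tensor_extend
     (\<lambda>ys. if length xs = length ys then tens (map2 (*) xs ys) else 0) U)"
  unfolding multilinear_def
proof (intro allI clinear_tensor_extend_param multilinear_mult)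
  fix xs zs ys :: "'a list"
  show "clinear (\<lambda>a. if length (xs @ a # zs) = length ys
      then tens (map2 (*) (xs @ a # zs) ys) else 0)"
    using clinear_map2(1)[of xs zs ys] clinear_const_zero
    by (cases "length xs + length zs + 1 = length ys") auto
qed

lemma tensor_mult_tens:
  "length xs = length ys \<Longrightarrow> tens xs \<odot> tens ys = tens (map2 (*) xs ys)"
  unfolding tensor_mult_def
  by (subst tensor_extend_tens[OF multilinear_mult_left], subst tensor_extend_tens[OF multilinear_mult])
    simp

lemma clinear_mult_left: "clinear (\<lambda>T. T \<odot> U)"
  unfolding tensor_mult_def by (rule clinear_tensor_extend[OF multilinear_mult_left])

lemma clinear_mult_right: "clinear (\<lambda>U. T \<odot> U)"
proof -
  have *: "T \<odot> U = tensor_extend (\<lambda>xs. tensor_extend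
     (\<lambda>ys. if length xs = length ys then tens (map2 (*) xs ys) else 0) U) T" for U
    by (simp add: tensor_mult_def)
  show ?thesis
    unfolding *
    by (intro clinear_tensor_extend_param multilinear_mult_left clinear_tensor_extend
        multilinear_mult)
qed

lemma
  assumes "\<And>b. clinear (\<lambda>a. f a b)" "\<And>a. clinear (f a)"
  shows clinear_sweedler: "clinear (sweedler f)"
    and sweedler_tens: "sweedler f (tens [a, b]) = f a b"
proof -
  have "multilinear (\<lambda>xs. if length xs = 2 then f (xs ! 0) (xs ! 1) else 0)"
  proof (rule multilinear_guard)
    fix xs ys :: "'a list"
    assume "length xs + length ys + 1 = 2"
    then consider y where "xs = []" "ys = [y]" | x where "xs = [x]" "ys = []"
      by (cases xs; cases ys) auto
    then show "clinear (\<lambda>a. f ((xs @ a # ys) ! 0) ((xs @ a # ys) ! 1))"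
      by cases (simp_all add: assms)
  qed
  then show "clinear (sweedler f)" "sweedler f (tens [a, b]) = f a b"
    by (simp_all add: sweedler_def clinear_tensor_extend tensor_extend_tens)
qed


section \<open>Hopf algebras\<close>

locale hopf_algebra =
  fixes \<Delta> :: "'a::complex_algebra_1 \<Rightarrow> 'a tensor"
    and \<epsilon> :: "'a \<Rightarrow> complex"
    and S :: "'a \<Rightarrow> 'a"
  assumes comult_linear: "clinear \<Delta>"
    and comult_degree: "\<Delta> h \<in> tensor_power 2"
    and counit_linear: "clinear \<epsilon>"
    and coassoc: "sweedler (\<lambda>a b. \<Delta> a \<otimes> tens [b]) (\<Delta> h) = sweedler (\<lambda>a b. tens [a] \<otimes> \<Delta> b) (\<Delta> h)"
    and counit_left: "sweedler (\<lambda>a b. \<epsilon> a *\<^sub>C b) (\<Delta> h) = h"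
    and counit_right: "sweedler (\<lambda>a b. \<epsilon> b *\<^sub>C a) (\<Delta> h) = h"
    and comult_mult: "\<Delta> (g * h) = \<Delta> g \<odot> \<Delta> h"
    and comult_one: "\<Delta> 1 = tens [1, 1]"
    and counit_mult: "\<epsilon> (g * h) = \<epsilon> g * \<epsilon> h"
    and counit_one: "\<epsilon> 1 = 1"
    and antipode_linear: "clinear S"
    and antipode_left: "sweedler (\<lambda>a b. S a * b) (\<Delta> h) = \<epsilon> h *\<^sub>C 1"
    and antipode_right: "sweedler (\<lambda>a b. a * S b) (\<Delta> h) = \<epsilon> h *\<^sub>C 1"

definition algebra_character :: "('a::complex_algebra_1 \<Rightarrow> complex) \<Rightarrow> bool" where
  "algebra_character \<delta> \<longleftrightarrow>
     clinear \<delta> \<and> (\<forall>g h. \<delta> (g * h) = \<delta> g * \<delta> h) \<and> (\<exists>h. \<delta> h \<noteq> 0)"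

definition twisted_antipode ::
  "('a::complex_algebra_1 \<Rightarrow> 'a tensor) \<Rightarrow> ('a \<Rightarrow> 'a) \<Rightarrow> ('a \<Rightarrow> complex) \<Rightarrow> 'a \<Rightarrow> 'a" where
  "twisted_antipode \<Delta> S \<delta> h = sweedler (\<lambda>a b. \<delta> a *\<^sub>C S b) (\<Delta> h)"

text \<open>The iterated coproduct \<open>H \<rightarrow> H\<^bsup>\<otimes>n\<^esup>\<close>, which is the counit for \<open>n = 0\<close>.\<close>

fun iterated_comult ::
  "('a::complex_algebra_1 \<Rightarrow> 'a tensor) \<Rightarrow> ('a \<Rightarrow> complex) \<Rightarrow> nat \<Rightarrow> 'a \<Rightarrow> 'a tensor" where
  "iterated_comult \<Delta> \<epsilon> 0 h = \<epsilon> h *\<^sub>C tens []"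
| "iterated_comult \<Delta> \<epsilon> (Suc 0) h = tens [h]"
| "iterated_comult \<Delta> \<epsilon> (Suc (Suc n)) h =
     sweedler (\<lambda>a b. iterated_comult \<Delta> \<epsilon> (Suc n) a \<otimes> tens [b]) (\<Delta> h)"

definition diagonal_action ::
  "('a::complex_algebra_1 \<Rightarrow> 'a tensor) \<Rightarrow> ('a \<Rightarrow> complex) \<Rightarrow> nat \<Rightarrow> 'a \<Rightarrow> 'a tensor \<Rightarrow> 'a tensor" where
  "diagonal_action \<Delta> \<epsilon> n g T = iterated_comult \<Delta> \<epsilon> n g \<odot> T"


section \<open>Cyclic modules\<close>

text \<open>Modules over Connes' cyclic category in the cosimplicial convention, given by the standard
  presentation of the category. The degree index of each operator is the degree of its source:
  \<open>d n i : V n \<rightarrow> V (n + 1)\<close> for \<open>0 \<le> i \<le> n + 1\<close>, \<open>s n i : V n \<rightarrow> V (n - 1)\<close> for \<open>0 \<le> i \<le> n - 1\<close>,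
  and \<open>t n : V n \<rightarrow> V n\<close>.\<close>

definition linear_map_between ::
  "'v::complex_vector set \<Rightarrow> 'w::complex_vector set \<Rightarrow> ('v \<Rightarrow> 'w) \<Rightarrow> bool" where
  "linear_map_between V W f \<longleftrightarrow>
     (\<forall>x\<in>V. f x \<in> W) \<and>
     (\<forall>x\<in>V. \<forall>y\<in>V. f (x + y) = f x + f y) \<and> (\<forall>c. \<forall>x\<in>V. f (c *\<^sub>C x) = c *\<^sub>C f x)"

locale cyclic_module =
  fixes V :: "nat \<Rightarrow> 'v::complex_vector set"
    and d s :: "nat \<Rightarrow> nat \<Rightarrow> 'v \<Rightarrow> 'v"
    and t :: "nat \<Rightarrow> 'v \<Rightarrow> 'v"
  assumes subspace: "cvec.subspace (V n)"
    and d_linear: "i \<le> n + 1 \<Longrightarrow> linear_map_between (V n) (V (n + 1)) (d n i)"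
    and s_linear: "i \<le> n \<Longrightarrow> linear_map_between (V (n + 1)) (V n) (s (n + 1) i)"
    and t_linear: "linear_map_between (V n) (V n) (t n)"
    and d_d: "x \<in> V n \<Longrightarrow> i < j \<Longrightarrow> j \<le> n + 2 \<Longrightarrow>
      d (n + 1) j (d n i x) = d (n + 1) i (d n (j - 1) x)"
    and s_s: "x \<in> V (n + 2) \<Longrightarrow> i \<le> j \<Longrightarrow> j \<le> n \<Longrightarrow>
      s (n + 1) j (s (n + 2) i x) = s (n + 1) i (s (n + 2) (j + 1) x)"
    and s_d_less: "x \<in> V n \<Longrightarrow> i < j \<Longrightarrow> j \<le> n \<Longrightarrow>
      s (n + 1) j (d n i x) = d (n - 1) i (s n (j - 1) x)"
    and s_d_eq: "x \<in> V n \<Longrightarrow> j \<le> n \<Longrightarrow> i = j \<or> i = j + 1 \<Longrightarrow> s (n + 1) j (d n i x) = x"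
    and s_d_greater: "x \<in> V n \<Longrightarrow> j + 1 < i \<Longrightarrow> i \<le> n + 1 \<Longrightarrow>
      s (n + 1) j (d n i x) = d (n - 1) (i - 1) (s n j x)"
    and t_d: "x \<in> V n \<Longrightarrow> 1 \<le> i \<Longrightarrow> i \<le> n + 1 \<Longrightarrow> t (n + 1) (d n i x) = d n (i - 1) (t n x)"
    and t_d_0: "x \<in> V n \<Longrightarrow> t (n + 1) (d n 0 x) = d n (n + 1) x"
    and t_s: "x \<in> V (n + 1) \<Longrightarrow> 1 \<le> i \<Longrightarrow> i \<le> n \<Longrightarrow>
      t n (s (n + 1) i x) = s (n + 1) (i - 1) (t (n + 1) x)"
    and t_s_0: "x \<in> V (n + 1) \<Longrightarrow> t n (s (n + 1) 0 x) = s (n + 1) n (t (n + 1) (t (n + 1) x))"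
    and t_cyclic: "x \<in> V n \<Longrightarrow> (t n ^^ (n + 1)) x = x"


section \<open>The structure maps of the cyclic module of a Hopf algebra with character\<close>

text \<open>Each map in degree \<open>n\<close> is the linear extension of its formula on pure tensors of degree \<open>n\<close> (and
  zero on the other degrees). Since lists are indexed from \<open>0\<close>, the entry \<open>h\<^sup>i\<close> of
  \<open>hs = [h\<^sup>1, \<dots>, h\<^sup>n]\<close> is \<open>hs ! (i - 1)\<close>. On degree \<open>0\<close> the cyclic operator is the identity.\<close>

definition hopf_d ::
  "('a::complex_algebra_1 \<Rightarrow> 'a tensor) \<Rightarrow> nat \<Rightarrow> nat \<Rightarrow> 'a tensor \<Rightarrow> 'a tensor" where
  "hopf_d \<Delta> n i = tensor_extend (\<lambda>hs.
     if length hs = n then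
       if i = 0 then tens (1 # hs)
       else if i \<le> n then tens (take (i - 1) hs) \<otimes> \<Delta> (hs ! (i - 1)) \<otimes> tens (drop i hs)
       else tens (hs @ [1])
     else 0)"

definition hopf_s ::
  "('a::complex_algebra_1 \<Rightarrow> complex) \<Rightarrow> nat \<Rightarrow> nat \<Rightarrow> 'a tensor \<Rightarrow> 'a tensor" where
  "hopf_s \<epsilon> n i = tensor_extend (\<lambda>hs.
     if length hs = n \<and> i < n then \<epsilon> (hs ! i) *\<^sub>C tens (take i hs @ drop (i + 1) hs) else 0)"

definition hopf_t ::
  "('a::complex_algebra_1 \<Rightarrow> 'a tensor) \<Rightarrow> ('a \<Rightarrow> complex) \<Rightarrow> ('a \<Rightarrow> 'a) \<Rightarrow> ('a \<Rightarrow> complex) \<Rightarrow>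
    nat \<Rightarrow> 'a tensor \<Rightarrow> 'a tensor" where
  "hopf_t \<Delta> \<epsilon> S \<delta> n = tensor_extend (\<lambda>hs.
     if length hs = n then
       (case hs of
          [] \<Rightarrow> tens []
        | h # hs' \<Rightarrow> diagonal_action \<Delta> \<epsilon> n (twisted_antipode \<Delta> S \<delta> h) (tens (hs' @ [1])))
     else 0)"

text \<open>For a Hopf algebra and a character these formulas are multilinear, so the maps are indeed given
  by them on pure tensors.\<close>

context hopf_algebra
begin

lemma multilinear_d:
  "multilinear (\<lambda>hs.
     if length hs = n then
       if i = 0 then tens (1 # hs)
       else if i \<le> n then tens (take (i - 1) hs) \<otimes> \<Delta> (hs ! (i - 1)) \<otimes> tens (drop i hs)
       else tens (hs @ [1])
     else 0)"
proof (rule multilinear_guard)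
  fix xs ys :: "'a list"
  assume n: "length xs + length ys + 1 = n"
  let ?f = "\<lambda>a. tens (take (i - 1) (xs @ a # ys)) \<otimes> \<Delta> ((xs @ a # ys) ! (i - 1)) \<otimes> tens (drop i (xs @ a # ys))"
  have mid: "clinear ?f" if i: "i \<noteq> 0" "i \<le> n"
  proof -
    consider "i - 1 < length xs" | "i - 1 = length xs" | "length xs < i - 1"
      by linarith
    then show ?thesis
    proof cases
      case 1
      have "clinear (\<lambda>a. tens (take (i - 1) xs) \<otimes> \<Delta> (xs ! (i - 1)) \<otimes> tens (drop i xs @ a # ys))"
        by (intro clinear_compose[OF clinear_append_right] clinear_tens)
      with 1 i show ?thesis
        by (simp add: nth_append)
    next
      case 2
      have "clinear (\<lambda>a. tens xs \<otimes> \<Delta> a \<otimes> tens ys)"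
        by (intro clinear_compose[OF clinear_append_right] clinear_compose[OF clinear_append_left]
            comult_linear)
      moreover from 2 i have "i = Suc (length xs)"
        by simp
      ultimately show ?thesis
        by simp
    next
      case 3
      then obtain k where k: "i = Suc (Suc (length xs + k))"
        using i by (metis One_nat_def Suc_diff_Suc add_Suc_right diff_zero less_iff_Suc_add not_gr0)
      have "clinear (\<lambda>a. tens (xs @ a # take k ys) \<otimes> \<Delta> (ys ! k) \<otimes> tens (drop (Suc k) ys))"
        by (intro clinear_compose[OF clinear_append_left] clinear_tens)
      with k show ?thesis
        by (simp add: nth_append)
    qed
  qed
  show "clinear (\<lambda>a. if i = 0 then tens (1 # xs @ a # ys)
     else if i \<le> n then ?f a else tens ((xs @ a # ys) @ [1]))"
    using clinear_tens[of "1 # xs" ys] clinear_tens[of xs "ys @ [1]"] mid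
    by (cases "i = 0"; cases "i \<le> n") simp_all
qed

lemma clinear_hopf_d: "clinear (hopf_d \<Delta> n i)"
  unfolding hopf_d_def by (rule clinear_tensor_extend[OF multilinear_d])

lemma hopf_d_tens:
  "length hs = n \<Longrightarrow> hopf_d \<Delta> n 0 (tens hs) = tens (1 # hs)"
  "length hs = n \<Longrightarrow> 1 \<le> i \<Longrightarrow> i \<le> n \<Longrightarrow>
     hopf_d \<Delta> n i (tens hs) = tens (take (i - 1) hs) \<otimes> \<Delta> (hs ! (i - 1)) \<otimes> tens (drop i hs)"
  "length hs = n \<Longrightarrow> hopf_d \<Delta> n (n + 1) (tens hs) = tens (hs @ [1])"
  unfolding hopf_d_def by (subst tensor_extend_tens[OF multilinear_d]; simp)+

lemma multilinear_s:
  "multilinear (\<lambda>hs. if length hs = n \<and> i < n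
     then \<epsilon> (hs ! i) *\<^sub>C tens (take i hs @ drop (i + 1) hs) else 0)"
proof (cases "i < n")
  case True
  have "multilinear (\<lambda>hs. if length hs = n
     then \<epsilon> (hs ! i) *\<^sub>C tens (take i hs @ drop (i + 1) hs) else 0)"
  proof (rule multilinear_guard)
    fix xs ys :: "'a list"
    assume n: "length xs + length ys + 1 = n"
    let ?f = "\<lambda>a. \<epsilon> ((xs @ a # ys) ! i) *\<^sub>C tens (take i (xs @ a # ys) @ drop (i + 1) (xs @ a # ys))"
    have scale: "clinear (\<lambda>T. c *\<^sub>C T)" for c
      by (rule clinearI) (simp_all add: scaleC_add_right scaleC_scaleC mult.commute)
    consider "i < length xs" | "i = length xs" | "length xs < i"
      by linarith
    then show "clinear ?f"
    proof cases
      case 1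
      have "clinear (\<lambda>a. \<epsilon> (xs ! i) *\<^sub>C tens ((take i xs @ drop (i + 1) xs) @ a # ys))"
        by (intro clinear_compose[OF scale] clinear_tens)
      with 1 show ?thesis
        by (simp add: nth_append)
    next
      case 2
      have "clinear (\<lambda>a. \<epsilon> a *\<^sub>C tens (xs @ ys))"
        by (rule clinearI) (simp_all add: clinear_add[OF counit_linear]
            clinear_scale[OF counit_linear] scaleC_add_left scaleC_scaleC scaleC_complex_def)
      with 2 show ?thesis
        by simp
    next
      case 3
      then obtain k where k: "i = Suc (length xs + k)"
        using less_iff_Suc_add by auto
      have "clinear (\<lambda>a. \<epsilon> (ys ! k) *\<^sub>C tens (xs @ a # take k ys @ drop (Suc k) ys))"
        by (intro clinear_compose[OF scale] clinear_tens)
      with k show ?thesis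
        by (simp add: nth_append)
    qed
  qed
  with True show ?thesis
    by simp
next
  case False
  then show ?thesis
    by (simp add: multilinear_def clinear_const_zero)
qed

lemma clinear_hopf_s: "clinear (hopf_s \<epsilon> n i)"
  unfolding hopf_s_def by (rule clinear_tensor_extend[OF multilinear_s])

lemma hopf_s_tens:
  "length hs = n \<Longrightarrow> i < n \<Longrightarrow>
     hopf_s \<epsilon> n i (tens hs) = \<epsilon> (hs ! i) *\<^sub>C tens (take i hs @ drop (i + 1) hs)"
  unfolding hopf_s_def by (subst tensor_extend_tens[OF multilinear_s]) simp

lemma clinear_iterated_comult: "clinear (iterated_comult \<Delta> \<epsilon> n)"
proof (induction n rule: induct_nat_012)
  case 0
  show ?case
    by (rule clinearI) (simp_all add: clinear_add[OF counit_linear]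
        clinear_scale[OF counit_linear] scaleC_add_left scaleC_scaleC scaleC_complex_def)
next
  case 1
  show ?case
    using clinear_tens[of "[]" "[]"] by simp
next
  case (ge2 n)
  have "clinear (\<lambda>h. sweedler (\<lambda>a b. iterated_comult \<Delta> \<epsilon> (Suc n) a \<otimes> tens [b]) (\<Delta> h))"
    using clinear_tens[of "[]" "[]"]
    by (intro clinear_compose[OF clinear_sweedler comult_linear]
        clinear_compose[OF clinear_append_left ge2(2)] clinear_compose[OF clinear_append_right]) simp
  then show ?case
    by simp
qed

lemma clinear_twisted_antipode:
  assumes "algebra_character \<delta>"
  shows "clinear (twisted_antipode \<Delta> S \<delta>)"
proof -
  have \<delta>: "clinear \<delta>"
    using assms by (simp add: algebra_character_def)
  have "clinear (\<lambda>a. \<delta> a *\<^sub>C S b)" "clinear (\<lambda>b. \<delta> a *\<^sub>C S b)" for a b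
    by (rule clinearI; simp add: clinear_add[OF \<delta>] clinear_scale[OF \<delta>]
        clinear_add[OF antipode_linear] clinear_scale[OF antipode_linear]
        scaleC_add_left scaleC_add_right scaleC_scaleC scaleC_complex_def mult.commute)+
  then have "clinear (\<lambda>h. twisted_antipode \<Delta> S \<delta> h)"
    unfolding twisted_antipode_def by (intro clinear_compose[OF clinear_sweedler comult_linear])
  then show ?thesis .
qed

lemma multilinear_t:
  assumes "algebra_character \<delta>"
  shows "multilinear (\<lambda>hs.
     if length hs = n then
       (case hs of
          [] \<Rightarrow> tens []
        | h # hs' \<Rightarrow> diagonal_action \<Delta> \<epsilon> n (twisted_antipode \<Delta> S \<delta> h) (tens (hs' @ [1])))
     else 0)"
proof (rule multilinear_guard)
  fix xs ys :: "'a list"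
  show "clinear (\<lambda>a. case xs @ a # ys of
          [] \<Rightarrow> tens []
        | h # hs' \<Rightarrow> diagonal_action \<Delta> \<epsilon> n (twisted_antipode \<Delta> S \<delta> h) (tens (hs' @ [1])))"
  proof (cases xs)
    case Nil
    have "clinear (\<lambda>a. diagonal_action \<Delta> \<epsilon> n (twisted_antipode \<Delta> S \<delta> a) (tens (ys @ [1])))"
      unfolding diagonal_action_def
      by (intro clinear_compose[OF clinear_mult_left] clinear_compose[OF clinear_iterated_comult]
          clinear_twisted_antipode assms)
    with Nil show ?thesis
      by simp
  next
    case (Cons x xs')
    have "clinear (\<lambda>a. diagonal_action \<Delta> \<epsilon> n (twisted_antipode \<Delta> S \<delta> x) (tens (xs' @ a # ys @ [1])))"
      unfolding diagonal_action_def
      by (intro clinear_compose[OF clinear_mult_right] clinear_tens)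
    with Cons show ?thesis
      by simp
  qed
qed

lemma clinear_hopf_t: "algebra_character \<delta> \<Longrightarrow> clinear (hopf_t \<Delta> \<epsilon> S \<delta> n)"
  unfolding hopf_t_def by (rule clinear_tensor_extend[OF multilinear_t])

lemma hopf_t_tens:
  "algebra_character \<delta> \<Longrightarrow> hopf_t \<Delta> \<epsilon> S \<delta> 0 (tens []) = tens []"
  "algebra_character \<delta> \<Longrightarrow> length hs = n \<Longrightarrow>
     hopf_t \<Delta> \<epsilon> S \<delta> (n + 1) (tens (h # hs))
       = diagonal_action \<Delta> \<epsilon> (n + 1) (twisted_antipode \<Delta> S \<delta> h) (tens (hs @ [1]))"
  unfolding hopf_t_def by (subst tensor_extend_tens[OF multilinear_t]; simp)+

end

end

theory Submission
  imports Defs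
begin

text \<open>Write \<open>\<pi> (h\<^sub>0, \<dots>, h\<^sub>n) = S\<^sub>\<delta> h\<^sub>0 \<cdot> (h\<^sub>1, \<dots>, h\<^sub>n)\<close>, so that \<open>\<pi> (1, h\<^sub>1, \<dots>, h\<^sub>n) = (h\<^sub>1, \<dots>, h\<^sub>n)\<close>.
  Since \<open>S\<^sub>\<delta>\<close> is an anti-homomorphism of algebras with \<open>\<Delta> (S\<^sub>\<delta> h) = \<Sum> S h\<^sub>1 \<otimes> S\<^sub>\<delta> h\<^sub>0\<close>, the terms
  \<open>S (\<dots>) (\<dots>)\<close> that appear when \<open>t\<close> is applied to \<open>\<pi> (h\<^sub>0, \<dots>, h\<^sub>n)\<close> cancel, and
  \<open>t (\<pi> (h\<^sub>0, \<dots>, h\<^sub>n)) = \<pi> (h\<^sub>1, \<dots>, h\<^sub>n, S\<^sub>\<delta>\<^sup>2 h\<^sub>0)\<close>. Iterating this \<open>n + 1\<close> times from \<open>h\<^sub>0 = 1\<close> gives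
  the formula for the power of \<open>t\<close>. The other cocyclic identities hold for every character, and
  degree 1 of \<open>t\<^bsup>n+1\<^esup> = 1\<close> already forces \<open>S\<^sub>\<delta>\<^sup>2 = id\<close>.\<close>

section \<open>Tensor powers\<close>

lemma clinear_ident: "clinear (\<lambda>x. x)"
  by (rule clinearI) simp_all

lemma clinear_scale_right: "clinear f \<Longrightarrow> clinear (\<lambda>x. c *\<^sub>C f x)"
  by (rule clinearI) (simp_all add: clinear_add clinear_scale scaleC_add_right scaleC_scaleC mult.commute)

lemma clinear_scale_left: "clinear f \<Longrightarrow> clinear (\<lambda>x. f x *\<^sub>C v)"
  by (rule clinearI)
    (simp_all add: clinear_add clinear_scale scaleC_add_left scaleC_scaleC scaleC_complex_def)

lemma clinear_times_left:
  fixes b :: "'a::complex_algebra_1"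
  shows "clinear f \<Longrightarrow> clinear (\<lambda>x. f x * b)"
  by (rule clinearI) (simp_all add: clinear_add clinear_scale distrib_right mult_scaleC_left)

lemma clinear_times_right:
  fixes b :: "'a::complex_algebra_1"
  shows "clinear f \<Longrightarrow> clinear (\<lambda>x. b * f x)"
  by (rule clinearI) (simp_all add: clinear_add clinear_scale distrib_left mult_scaleC_right)

lemma clinear_single: "clinear f \<Longrightarrow> clinear (\<lambda>x. tens [f x])"
  using clinear_compose[OF clinear_tens[of "[]" "[]"]] by simp

lemmas linear_intros = clinear_ident clinear_scale_right clinear_scale_left clinear_times_left
  clinear_times_right clinear_single clinear_compose[OF clinear_append_left]
  clinear_compose[OF clinear_append_right]

lemma clinear_sum_list:
  "clinear f \<Longrightarrow> f (\<Sum>x\<leftarrow>xs. g x) = (\<Sum>x\<leftarrow>xs. f (g x))"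
  by (induction xs) (simp_all add: clinear_zero clinear_add)

lemma sum_list_swap:
  fixes f :: "'b \<Rightarrow> 'c \<Rightarrow> 'd::comm_monoid_add"
  shows "(\<Sum>x\<leftarrow>xs. \<Sum>y\<leftarrow>ys. f x y) = (\<Sum>y\<leftarrow>ys. \<Sum>x\<leftarrow>xs. f x y)"
  by (induction xs) (simp_all add: sum_list_addf)

lemma list_split_at:
  assumes "i < length xs"
  obtains us v ws where "xs = us @ v # ws" "length us = i"
  using id_take_nth_drop[OF assms] assms by (metis length_take min.absorb4)

text \<open>For two operators working at different slots of one pure tensor; \<open>ms\<close> holds
  the entries strictly between them, which accounts for the \<open>Suc\<close>.\<close>

lemma list_split_at2:
  assumes "i < j" "j < length xs"
  obtains us v ms w ws where "xs = us @ v # ms @ w # ws" "length us = i" "Suc (i + length ms) = j"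
proof -
  obtain us v xs' where 1: "xs = us @ v # xs'" "length us = i"
    using assms by (metis list_split_at order.strict_trans)
  then have "j - Suc i < length xs'"
    using assms by simp
  then obtain ms w ws where "xs' = ms @ w # ws" "length ms = j - Suc i"
    by (rule list_split_at)
  then show thesis
    using 1 assms that[of us v ms w ws] by simp
qed

section \<open>Degrees of tensors and the concatenation product\<close>

lemma tens_in_tensor_power: "tens xs \<in> tensor_power (length xs)"
  unfolding tensor_power_def by (rule cvec.span_base) auto

lemma tensor_power_induct [consumes 1, case_names zero step]:
  assumes "x \<in> tensor_power n" and "P 0"
    and "\<And>c xs y. length xs = n \<Longrightarrow> P y \<Longrightarrow> P (c *\<^sub>C tens xs + y)"
  shows "P x"
  using assms(1) unfolding tensor_power_def
  by (induction rule: cvec.span_induct_alt) (use assms(2,3) in auto)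

text \<open>The structure maps follow their formulas only on lists of one length, so linear maps are
  compared on a single degree; elsewhere they may differ.\<close>

lemma tensor_power_eqI:
  assumes "clinear f" "clinear g" "x \<in> tensor_power n"
    and "\<And>xs. length xs = n \<Longrightarrow> f (tens xs) = g (tens xs)"
  shows "f x = g x"
  using assms(3)
  by (induction rule: tensor_power_induct) (simp_all add: assms(1,2,4) clinear_zero clinear_add clinear_scale)

lemma subspace_tensor_power: "cvec.subspace (tensor_power n)"
  unfolding tensor_power_def by (rule cvec.subspace_span)

lemma clinear_tensor_power:
  assumes "clinear f" "x \<in> tensor_power n"
    and "\<And>xs. length xs = n \<Longrightarrow> f (tens xs) \<in> tensor_power m"
  shows "f x \<in> tensor_power m"
  using assms(2)
  by (induction rule: tensor_power_induct)
    (simp_all add: assms(1,3) clinear_zero clinear_add clinear_scale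
      cvec.subspace_add cvec.subspace_scale cvec.subspace_0 subspace_tensor_power)

lemma append_tensor_power:
  assumes "x \<in> tensor_power m" "y \<in> tensor_power n"
  shows "x \<otimes> y \<in> tensor_power (m + n)"
proof (rule clinear_tensor_power[OF clinear_append_left assms(1)])
  fix xs :: "'a list" assume xs: "length xs = m"
  show "tens xs \<otimes> y \<in> tensor_power (m + n)"
  proof (rule clinear_tensor_power[OF clinear_append_right assms(2)])
    fix ys :: "'a list" assume "length ys = n"
    with xs show "tens xs \<otimes> tens ys \<in> tensor_power (m + n)"
      using tens_in_tensor_power[of "xs @ ys"] by (simp add: tensor_append_tens)
  qed
qed

lemma mult_tensor_power:
  assumes "x \<in> tensor_power n" "y \<in> tensor_power n"
  shows "x \<odot> y \<in> tensor_power n"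
proof (rule clinear_tensor_power[OF clinear_mult_left assms(1)])
  fix xs :: "'a list" assume xs: "length xs = n"
  show "tens xs \<odot> y \<in> tensor_power n"
  proof (rule clinear_tensor_power[OF clinear_mult_right assms(2)])
    fix ys :: "'a list" assume "length ys = n"
    with xs show "tens xs \<odot> tens ys \<in> tensor_power n"
      using tens_in_tensor_power[of "map2 (*) xs ys"] by (simp add: tensor_mult_tens)
  qed
qed

lemma tensor_append_assoc: "(x \<otimes> y) \<otimes> z = x \<otimes> y \<otimes> z"
proof -
  \<comment> \<open>The factors are freed one at a time from left to right; those further right stay
    pure tensors meanwhile.\<close>
  have "(\<lambda>x. (x \<otimes> tens ys) \<otimes> tens zs) = (\<lambda>x. x \<otimes> tens ys \<otimes> tens zs)" for ys zs :: "'a list"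
    by (rule clinear_tensor_eqI) (simp_all add: tensor_append_tens linear_intros)
  then have "(\<lambda>y. (x \<otimes> y) \<otimes> tens zs) = (\<lambda>y. x \<otimes> y \<otimes> tens zs)" for zs
    by (intro clinear_tensor_eqI linear_intros) metis
  then have "(\<lambda>z. (x \<otimes> y) \<otimes> z) = (\<lambda>z. x \<otimes> y \<otimes> z)"
    by (intro clinear_tensor_eqI linear_intros) metis
  then show ?thesis by metis
qed

lemma tensor_append_nil: "tens [] \<otimes> x = x"
proof -
  have "(\<lambda>x. tens [] \<otimes> x) = (\<lambda>x::'a tensor. x)"
    by (rule clinear_tensor_eqI) (simp_all add: tensor_append_tens linear_intros)
  then show ?thesis by metis
qed

lemma tensor_append_nil_right: "x \<otimes> tens [] = x"
proof -
  have "(\<lambda>x. x \<otimes> tens []) = (\<lambda>x::'a tensor. x)"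
    by (rule clinear_tensor_eqI) (simp_all add: tensor_append_tens linear_intros)
  then show ?thesis by metis
qed

lemma tens_Cons: "tens (x # xs) = tens [x] \<otimes> tens xs"
  by (simp add: tensor_append_tens)

lemma append_single_mult:
  assumes "x \<in> tensor_power n" "y \<in> tensor_power n"
  shows "(tens [a] \<otimes> x) \<odot> (tens [b] \<otimes> y) = tens [a * b] \<otimes> (x \<odot> y)"
proof (rule tensor_power_eqI[OF _ _ assms(1)])
  fix xs :: "'a list" assume xs: "length xs = n"
  show "(tens [a] \<otimes> tens xs) \<odot> (tens [b] \<otimes> y) = tens [a * b] \<otimes> (tens xs \<odot> y)"
    by (rule tensor_power_eqI[OF _ _ assms(2)])
      (simp_all add: xs tensor_append_tens tensor_mult_tens linear_intros
        clinear_compose[OF clinear_mult_right] clinear_mult_right)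
qed (intro linear_intros clinear_compose[OF clinear_mult_left])+

text \<open>Reading off the entry of a list of length 1, with value 0 on all other lengths, is
  multilinear; the induced linear map recovers \<open>a\<close> from \<open>tens [a]\<close>. This
  turns an equality in degree 1 into one in the algebra.\<close>

lemma tens_single_inject: "tens [a] = tens [b] \<longleftrightarrow> a = b"
proof
  have "multilinear (\<lambda>xs. if length xs = 1 then hd xs else 0 :: 'a)"
  proof (rule multilinear_guard)
    fix xs ys :: "'a list" assume "length xs + length ys + 1 = 1"
    then show "clinear (\<lambda>a. hd (xs @ a # ys))"
      by (simp add: clinear_ident)
  qed
  from tensor_extend_tens[OF this, of "[a]"] tensor_extend_tens[OF this, of "[b]"]
  show "tens [a] = tens [b] \<Longrightarrow> a = b"
    by simp
qed simp

section \<open>Sweedler sums\<close>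

context hopf_algebra
begin

text \<open>Degree 2 means a finite sum of scalar multiples of pure tensors
  \<open>tens [a, b]\<close>; each scalar is absorbed into the first entry.\<close>

lemma comult_eq_sum_list: "\<exists>ps. \<Delta> h = (\<Sum>(a, b)\<leftarrow>ps. tens [a, b])"
  using comult_degree[of h]
proof (induction rule: tensor_power_induct)
  case zero
  then show ?case by (intro exI[of _ "[]"]) simp
next
  case (step c xs y)
  then obtain ps where ps: "y = (\<Sum>(a, b)\<leftarrow>ps. tens [a, b])" by blast
  obtain a b where "xs = [a, b]"
    using step(1) by (metis (no_types) Suc_length_conv length_0_conv numeral_2_eq_2)
  then have "c *\<^sub>C tens xs + y = (\<Sum>(a, b)\<leftarrow>(c *\<^sub>C a, b) # ps. tens [a, b])"
    using clinear_scale[OF clinear_tens[of "[]" "[b]"]] by (simp add: ps)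
  then show ?case by blast
qed

text \<open>Unlike \<^const>\<open>sweedler\<close>, this is a genuine finite sum for every \<open>f\<close>, so that sums can
  be interchanged and rewritten without linearity conditions.\<close>

definition cop :: "'a \<Rightarrow> ('a \<Rightarrow> 'a \<Rightarrow> 'b::complex_vector) \<Rightarrow> 'b" where
  "cop h f = (\<Sum>(a, b)\<leftarrow>(SOME ps. \<Delta> h = (\<Sum>(a, b)\<leftarrow>ps. tens [a, b])). f a b)"

lemma comult_cop: "\<Delta> h = cop h (\<lambda>a b. tens [a, b])"
  unfolding cop_def by (rule someI_ex[OF comult_eq_sum_list])

lemma clinear_cop: "clinear L \<Longrightarrow> L (cop h f) = cop h (\<lambda>a b. L (f a b))"
  unfolding cop_def case_prod_beta by (rule clinear_sum_list)

lemma cop_swap: "cop g (\<lambda>a b. cop h (f a b)) = cop h (\<lambda>c d. cop g (\<lambda>a b. f a b c d))"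
  unfolding cop_def case_prod_beta by (rule sum_list_swap)

text \<open>The choice of a decomposition hidden in \<open>cop\<close> is harmless for bilinear
  \<open>f\<close>: the sum agrees with the value of the induced linear map.\<close>

lemma sweedler_cop:
  assumes "\<And>b. clinear (\<lambda>a. f a b)" "\<And>a. clinear (f a)"
  shows "sweedler f (\<Delta> h) = cop h f"
  using assms
  by (simp add: comult_cop[of h] clinear_cop[OF clinear_sweedler] sweedler_tens)

text \<open>The chosen decompositions of coproducts need not depend linearly on the element, so
  linearity is obtained through \<open>sweedler\<close>; this is where bilinearity of
  \<open>f\<close> enters.\<close>

lemma clinear_cop_left:
  assumes "\<And>b. clinear (\<lambda>a. f a b)" "\<And>a. clinear (\<lambda>b. f a b)" and g: "clinear g"
  shows "clinear (\<lambda>x. cop (g x) f)"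
  using clinear_compose[OF clinear_compose[OF clinear_sweedler comult_linear] g, of f]
  by (simp add: sweedler_cop assms)

lemma clinear_cop_right:
  assumes "\<And>a b. clinear (\<lambda>x. f x a b)"
  shows "clinear (\<lambda>x. cop h (f x))"
  by (rule clinearI; unfold cop_def case_prod_beta)
    (simp_all add: clinear_add[OF assms] clinear_scale[OF assms] sum_list_addf
      clinear_sum_list[OF clinear_scale_right[OF clinear_ident]])

lemmas cop_intros = linear_intros clinear_compose[OF antipode_linear] clinear_compose[OF counit_linear]
  clinear_cop_right clinear_cop_left

lemma cop_append_left: "cop h f \<otimes> x = cop h (\<lambda>a b. f a b \<otimes> x)"
  by (rule clinear_cop[OF clinear_append_left])

lemma cop_append_right: "x \<otimes> cop h f = cop h (\<lambda>a b. x \<otimes> f a b)"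
  by (rule clinear_cop[OF clinear_append_right])

lemma cop_scale: "c *\<^sub>C cop h f = cop h (\<lambda>a b. c *\<^sub>C f a b)"
  by (rule clinear_cop[OF clinear_scale_right[OF clinear_ident]])

lemma cop_tensor_power:
  "(\<And>a b. f a b \<in> tensor_power n) \<Longrightarrow> cop h f \<in> tensor_power n"
proof -
  assume f: "\<And>a b. f a b \<in> tensor_power n"
  have "(\<Sum>p\<leftarrow>ps. f (fst p) (snd p)) \<in> tensor_power n" for ps
    by (induction ps)
      (simp_all add: f cvec.subspace_add cvec.subspace_0 subspace_tensor_power)
  then show ?thesis
    unfolding cop_def case_prod_beta .
qed

lemma comult_tens_cop: "tens us \<otimes> \<Delta> h \<otimes> tens ws = cop h (\<lambda>a b. tens (us @ a # b # ws))"
  by (simp add: comult_cop[of h] cop_append_left cop_append_right tensor_append_tens)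

text \<open>The trilinear \<open>f\<close>, set to 0 off length 3, induces a linear map; applied to
  the coassociativity axiom in the third tensor power it gives the rule for
  \<open>cop\<close>.\<close>

lemma cop_coassoc:
  assumes "\<And>b c. clinear (\<lambda>a. f a b c)" "\<And>a c. clinear (\<lambda>b. f a b c)" "\<And>a b. clinear (\<lambda>c. f a b c)"
  shows "cop h (\<lambda>a b. cop a (\<lambda>c d. f c d b)) = cop h (\<lambda>a b. cop b (\<lambda>c d. f a c d))"
proof -
  let ?f = "\<lambda>xs. f (xs ! 0) (xs ! 1) (xs ! 2)"
  have f: "multilinear (\<lambda>xs. if length xs = 3 then ?f xs else 0)"
  proof (rule multilinear_guard)
    fix xs ys :: "'a list" assume "length xs + length ys + 1 = 3"
    then consider y z where "xs = []" "ys = [y, z]" | x z where "xs = [x]" "ys = [z]"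
      | x y where "xs = [x, y]" "ys = []"
      by (cases xs; cases ys; cases "tl xs"; cases "tl ys") auto
    then show "clinear (\<lambda>a. ?f (xs @ a # ys))"
      by cases (simp_all add: assms)
  qed
  have "clinear (\<lambda>a. \<Delta> a \<otimes> tens [b])" "clinear (\<lambda>b. \<Delta> a \<otimes> tens [b])"
    "clinear (\<lambda>a. tens [a] \<otimes> \<Delta> b)" "clinear (\<lambda>b. tens [a] \<otimes> \<Delta> b)" for a b
    by (intro linear_intros comult_linear)+
  then have eq: "cop h (\<lambda>a b. \<Delta> a \<otimes> tens [b]) = cop h (\<lambda>a b. tens [a] \<otimes> \<Delta> b)"
    using coassoc[of h] by (simp add: sweedler_cop)
  have left: "\<Delta> a \<otimes> tens [b] = cop a (\<lambda>c d. tens [c, d, b])" for a b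
    using comult_tens_cop[of "[]" a "[b]"] by (simp add: tensor_append_nil)
  have right: "tens [a] \<otimes> \<Delta> b = cop b (\<lambda>c d. tens [a, c, d])" for a b
    using comult_tens_cop[of "[a]" b "[]"] by (simp add: tensor_append_nil_right)
  from arg_cong[OF eq, of "tensor_extend (\<lambda>xs. if length xs = 3 then ?f xs else 0)"]
  show ?thesis
    by (simp add: left right clinear_cop[OF clinear_tensor_extend[OF f]] tensor_extend_tens[OF f])
qed

section \<open>The Hopf algebra axioms as rewrite rules for sums, inside a linear or bilinear
  context\<close>

lemma cop_counit_left: "clinear F \<Longrightarrow> cop h (\<lambda>a b. \<epsilon> a *\<^sub>C F b) = F h"
  using counit_left[of h]
  by (subst (asm) sweedler_cop)
    (auto intro!: linear_intros counit_linear simp: clinear_cop clinear_scale dest!: arg_cong[of _ _ F])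

lemma cop_counit_right: "clinear F \<Longrightarrow> cop h (\<lambda>a b. \<epsilon> b *\<^sub>C F a) = F h"
  using counit_right[of h]
  by (subst (asm) sweedler_cop)
    (auto intro!: linear_intros counit_linear simp: clinear_cop clinear_scale dest!: arg_cong[of _ _ F])

lemma cop_antipode_left: "clinear F \<Longrightarrow> cop h (\<lambda>a b. F (S a * b)) = \<epsilon> h *\<^sub>C F 1"
  using antipode_left[of h]
  by (subst (asm) sweedler_cop)
    (auto intro!: linear_intros antipode_linear simp: clinear_cop clinear_scale dest!: arg_cong[of _ _ F])

lemma cop_antipode_right: "clinear F \<Longrightarrow> cop h (\<lambda>a b. F (a * S b)) = \<epsilon> h *\<^sub>C F 1"
  using antipode_right[of h]
  by (subst (asm) sweedler_cop)
    (auto intro!: linear_intros antipode_linear simp: clinear_cop clinear_scale dest!: arg_cong[of _ _ F])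

text \<open>The decomposition of \<open>\<Delta> 1\<close> chosen by \<open>cop\<close> need not be
  \<open>[(1, 1)]\<close>; bilinearity gives the same value anyway.\<close>

lemma cop_one:
  assumes "\<And>b. clinear (\<lambda>a. f a b)" "\<And>a. clinear (\<lambda>b. f a b)"
  shows "cop 1 f = f 1 1"
  using sweedler_cop[of f 1] assms by (simp add: comult_one sweedler_tens)

lemma cop_mult:
  assumes "\<And>b. clinear (\<lambda>a. f a b)" "\<And>a. clinear (\<lambda>b. f a b)"
  shows "cop (g * h) f = cop g (\<lambda>a b. cop h (\<lambda>c d. f (a * c) (b * d)))"
proof -
  have "cop (g * h) f = sweedler f (\<Delta> g \<odot> \<Delta> h)"
    using assms by (simp add: sweedler_cop flip: comult_mult)
  also have "\<Delta> g \<odot> \<Delta> h = cop g (\<lambda>a b. cop h (\<lambda>c d. tens [a * c, b * d]))"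
    by (simp add: comult_cop[of g] comult_cop[of h] clinear_cop[OF clinear_mult_left]
        clinear_cop[OF clinear_mult_right] tensor_mult_tens) (rule cop_swap)
  finally show ?thesis
    using assms by (simp add: clinear_cop[OF clinear_sweedler] sweedler_tens)
qed

section \<open>The antipode\<close>

lemma antipode_one: "S 1 = 1"
  using cop_antipode_left[OF clinear_ident, of 1]
  by (simp add: cop_one cop_intros antipode_linear counit_one scaleC_one)

text \<open>Applying \<open>\<epsilon>\<close> to the sum of \<open>a * S b\<close> gives
  \<open>\<epsilon> h\<close>, while multiplicativity and the counit axiom collapse the same sum to
  \<open>\<epsilon> (S h)\<close>.\<close>

lemma counit_antipode: "\<epsilon> (S h) = \<epsilon> h"
proof -
  have "\<epsilon> h = cop h (\<lambda>a b. \<epsilon> (a * S b))"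
    by (simp add: cop_antipode_right counit_linear counit_one scaleC_complex_def)
  also have "\<dots> = cop h (\<lambda>a b. \<epsilon> a *\<^sub>C \<epsilon> (S b))"
    by (simp add: counit_mult scaleC_complex_def)
  also have "\<dots> = \<epsilon> (S h)"
    by (rule cop_counit_left) (intro cop_intros antipode_linear)
  finally show ?thesis ..
qed

text \<open>Both sides are convolution inverses of the product \<open>H \<otimes> H \<rightarrow> H\<close>.\<close>

lemma antipode_mult: "S (g * h) = S h * S g"
proof -
  have "S h * S g = cop g (\<lambda>g\<^sub>1 g\<^sub>2. cop h (\<lambda>h\<^sub>1 h\<^sub>2. \<epsilon> (g\<^sub>1 * h\<^sub>1) *\<^sub>C (S h\<^sub>2 * S g\<^sub>2)))"
    by (simp add: counit_mult cop_counit_left cop_intros antipode_linear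
        flip: cop_scale cvec.scale_scale)
  \<comment> \<open>The antipode axiom, read backwards at \<open>g\<^sub>1 * h\<^sub>1\<close>,
    brings in the antipode of a product.\<close>
  also have "\<dots> = cop g (\<lambda>g\<^sub>1 g\<^sub>2. cop h (\<lambda>h\<^sub>1 h\<^sub>2. cop (g\<^sub>1 * h\<^sub>1) (\<lambda>a b. S a * b * (S h\<^sub>2 * S g\<^sub>2))))"
    using cop_antipode_left[of "\<lambda>x. x * (S h\<^sub>2 * S g\<^sub>2)" for h\<^sub>2 g\<^sub>2]
    by (simp add: cop_intros)
  also have "\<dots> = cop g (\<lambda>g\<^sub>1 g\<^sub>2. cop h (\<lambda>h\<^sub>1 h\<^sub>2. cop g\<^sub>1 (\<lambda>a b. cop h\<^sub>1 (\<lambda>c d.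
      S (a * c) * (b * d) * (S h\<^sub>2 * S g\<^sub>2)))))"
    by (simp add: cop_mult cop_intros antipode_linear)
  also have "\<dots> = cop g (\<lambda>g\<^sub>1 g\<^sub>2. cop g\<^sub>1 (\<lambda>a b. cop h (\<lambda>h\<^sub>1 h\<^sub>2. cop h\<^sub>1 (\<lambda>c d.
      S (a * c) * (b * d) * (S h\<^sub>2 * S g\<^sub>2)))))"
    by (subst cop_swap) (rule refl)
  \<comment> \<open>Coassociativity regroups the three legs of \<open>g\<close> and of
    \<open>h\<close>, so that \<open>d\<close> meets \<open>S h\<^sub>2\<close> and afterwards
    \<open>b\<close> meets \<open>S g\<^sub>2\<close>; the pair coming from \<open>h\<close> cancels
    first.\<close>
  also have "\<dots> = cop g (\<lambda>a g'. cop g' (\<lambda>b g\<^sub>2. cop h (\<lambda>c h'. cop h' (\<lambda>d h\<^sub>2.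
      S (a * c) * (b * d) * (S h\<^sub>2 * S g\<^sub>2)))))"
    by (subst cop_coassoc[where h = g], (intro cop_intros antipode_linear)+,
        subst cop_coassoc[where h = h], (intro cop_intros antipode_linear)+) (rule refl)
  also have "\<dots> = cop g (\<lambda>a g'. cop g' (\<lambda>b g\<^sub>2. cop h (\<lambda>c h'. \<epsilon> h' *\<^sub>C (S (a * c) * b * S g\<^sub>2))))"
    using cop_antipode_right[of "\<lambda>x. S (a * c) * b * x * S g\<^sub>2" for a b c g\<^sub>2]
    by (simp add: mult.assoc cop_intros)
  also have "\<dots> = cop g (\<lambda>a g'. cop g' (\<lambda>b g\<^sub>2. S (a * h) * b * S g\<^sub>2))"
    by (simp add: cop_counit_right cop_intros)
  also have "\<dots> = cop g (\<lambda>a g'. \<epsilon> g' *\<^sub>C S (a * h))"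
    using cop_antipode_right[of "\<lambda>x. S (a * h) * x" for a]
    by (simp add: mult.assoc cop_intros)
  also have "\<dots> = S (g * h)"
    by (simp add: cop_counit_right cop_intros)
  finally show ?thesis ..
qed

text \<open>Both sides are convolution inverses of \<open>\<Delta>\<close>, as maps into the tensor
  square, tested on the bilinear \<open>f\<close>. That the flipped map on the right is a right
  inverse is \<open>inner\<close>; that the left side is a left inverse is the antipode axiom pushed
  through the multiplicative \<open>\<Delta>\<close>.\<close>

lemma cop_antipode:
  assumes f: "\<And>b. clinear (\<lambda>a. f a b)" "\<And>a. clinear (\<lambda>b. f a b)"
  shows "cop (S h) f = cop h (\<lambda>a b. f (S b) (S a))"
proof -
  note f_intros = cop_intros antipode_linear clinear_compose[OF f(1)] clinear_compose[OF f(2)]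
  \<comment> \<open>The factors \<open>u\<close> and \<open>v\<close> will be the legs of
    \<open>S p\<close>, which multiply from the left. The middle pair \<open>y * S c\<close> cancels
    first, then the outer pair formed with \<open>x\<close>.\<close>
  have inner: "cop r (\<lambda>q b. cop q (\<lambda>x y. cop b (\<lambda>c d. f (u * (x * S d)) (v * (y * S c))))) = \<epsilon> r *\<^sub>C f u v"
    for r u v
  proof -
    have "cop r (\<lambda>q b. cop q (\<lambda>x y. cop b (\<lambda>c d. f (u * (x * S d)) (v * (y * S c)))))
      = cop r (\<lambda>x w. cop w (\<lambda>y b. cop b (\<lambda>c d. f (u * (x * S d)) (v * (y * S c)))))"
      by (rule cop_coassoc) (intro f_intros)+
    also have "\<dots> = cop r (\<lambda>x w. cop w (\<lambda>e d. cop e (\<lambda>y c. f (u * (x * S d)) (v * (y * S c)))))"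
      by (subst cop_coassoc, (intro f_intros)+) (rule refl)
    also have "\<dots> = cop r (\<lambda>x w. cop w (\<lambda>e d. \<epsilon> e *\<^sub>C f (u * (x * S d)) v))"
      using cop_antipode_right[of "\<lambda>z. f (u * (x * S d)) (v * z)" for x d] by (simp add: f_intros)
    also have "\<dots> = cop r (\<lambda>x w. f (u * (x * S w)) v)"
      by (simp add: cop_counit_left f_intros)
    also have "\<dots> = \<epsilon> r *\<^sub>C f u v"
      using cop_antipode_right[of "\<lambda>z. f (u * z) v" r] by (simp add: f_intros)
    finally show ?thesis .
  qed
  have "cop h (\<lambda>a b. f (S b) (S a)) = cop h (\<lambda>a' b'. \<epsilon> a' *\<^sub>C cop b' (\<lambda>a b. f (S b) (S a)))"
    by (simp add: cop_counit_left f_intros)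
  \<comment> \<open>\<open>\<epsilon> a'\<close> is traded for \<open>S p * q\<close> inside a map
    that is linear in \<open>z\<close> and starts with \<open>cop z\<close>; at \<open>z = 1\<close>
    this map returns the original sum, by \<open>cop_one\<close>.\<close>
  also have "\<dots> = cop h (\<lambda>a' b'. cop a' (\<lambda>p q. cop (S p * q) (\<lambda>x y. cop b' (\<lambda>c d. f (x * S d) (y * S c)))))"
    by (subst cop_antipode_left[where F = "\<lambda>z. cop z g" for g], (intro f_intros)+)
      (simp add: cop_one f_intros)
  also have "\<dots> = cop h (\<lambda>a' b'. cop a' (\<lambda>p q. cop (S p) (\<lambda>u v. cop q (\<lambda>x y.
      cop b' (\<lambda>c d. f (u * (x * S d)) (v * (y * S c)))))))"
    by (simp add: cop_mult f_intros mult.assoc)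
  also have "\<dots> = cop h (\<lambda>p r. cop r (\<lambda>q b. cop (S p) (\<lambda>u v. cop q (\<lambda>x y.
      cop b (\<lambda>c d. f (u * (x * S d)) (v * (y * S c)))))))"
    by (rule cop_coassoc) (intro f_intros)+
  also have "\<dots> = cop h (\<lambda>p r. cop (S p) (\<lambda>u v. \<epsilon> r *\<^sub>C f u v))"
    by (subst cop_swap) (simp add: inner)
  also have "\<dots> = cop (S h) f"
    by (simp add: cop_counit_right f_intros f flip: cop_scale)
  finally show ?thesis ..
qed

section \<open>The diagonal action\<close>

text \<open>Extends the recursion of the definition to \<open>n = 0\<close>, where the counit axiom
  absorbs the leg in degree 0.\<close>

lemma iterated_comult_Suc:
  "iterated_comult \<Delta> \<epsilon> (Suc n) h = cop h (\<lambda>a b. iterated_comult \<Delta> \<epsilon> n a \<otimes> tens [b])"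
proof (cases n)
  case 0
  have "(\<epsilon> a *\<^sub>C tens []) \<otimes> tens [b] = \<epsilon> a *\<^sub>C tens [b]" for a b :: 'a
    by (simp add: clinear_scale[OF clinear_append_left] tensor_append_nil)
  then show ?thesis
    using 0 by (simp add: cop_counit_left cop_intros)
next
  case (Suc m)
  have "clinear (\<lambda>a. iterated_comult \<Delta> \<epsilon> (Suc m) a \<otimes> tens [b])"
    "clinear (\<lambda>b. iterated_comult \<Delta> \<epsilon> (Suc m) a \<otimes> tens [b])" for a b
    by (intro cop_intros clinear_iterated_comult)+
  then show ?thesis
    using Suc by (simp add: sweedler_cop)
qed

text \<open>Lists grow at the head, whereas \<open>iterated_comult\<close> splits off its last leg;
  coassociativity lets the first leg be split off instead.\<close>

lemma iterated_comult_Suc_left: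
  "iterated_comult \<Delta> \<epsilon> (Suc n) h = cop h (\<lambda>a b. tens [a] \<otimes> iterated_comult \<Delta> \<epsilon> n b)"
proof (induction n arbitrary: h)
  case 0
  have "tens [b] \<otimes> (\<epsilon> a *\<^sub>C tens []) = \<epsilon> a *\<^sub>C tens [b]" for a b :: 'a
    by (simp add: clinear_scale[OF clinear_append_right] tensor_append_nil_right)
  then show ?case
    by (simp add: cop_counit_right cop_intros)
next
  case (Suc n)
  have "iterated_comult \<Delta> \<epsilon> (Suc (Suc n)) h
      = cop h (\<lambda>a b. cop a (\<lambda>c d. tens [c] \<otimes> iterated_comult \<Delta> \<epsilon> n d \<otimes> tens [b]))"
    by (simp only: iterated_comult_Suc[of "Suc n"] Suc.IH cop_append_left tensor_append_assoc)
  also have "\<dots> = cop h (\<lambda>a b. cop b (\<lambda>c d. tens [a] \<otimes> iterated_comult \<Delta> \<epsilon> n c \<otimes> tens [d]))"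
    by (rule cop_coassoc) (intro cop_intros clinear_compose[OF clinear_iterated_comult])+
  also have "\<dots> = cop h (\<lambda>a b. tens [a] \<otimes> iterated_comult \<Delta> \<epsilon> (Suc n) b)"
    by (simp only: iterated_comult_Suc cop_append_right)
  finally show ?case .
qed

lemma iterated_comult_tensor_power: "iterated_comult \<Delta> \<epsilon> n h \<in> tensor_power n"
proof (induction n arbitrary: h)
  case 0
  show ?case
    using cvec.subspace_scale[OF subspace_tensor_power tens_in_tensor_power[of "[]"]] by simp
next
  case (Suc n)
  have "iterated_comult \<Delta> \<epsilon> n a \<otimes> tens [b] \<in> tensor_power (Suc n)" for a b
    using append_tensor_power[OF Suc tens_in_tensor_power[of "[b]"]] by simp
  then show ?case
    unfolding iterated_comult_Suc by (rule cop_tensor_power)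
qed

lemma clinear_diagonal_action: "clinear f \<Longrightarrow> clinear (\<lambda>x. diagonal_action \<Delta> \<epsilon> n g (f x))"
  unfolding diagonal_action_def by (rule clinear_compose[OF clinear_mult_right])

lemma clinear_diagonal_action_left:
  "clinear f \<Longrightarrow> clinear (\<lambda>x. diagonal_action \<Delta> \<epsilon> n (f x) y)"
  unfolding diagonal_action_def
  by (rule clinear_compose[OF clinear_compose[OF clinear_mult_left clinear_iterated_comult]])

lemma diagonal_action_tensor_power:
  "x \<in> tensor_power n \<Longrightarrow> diagonal_action \<Delta> \<epsilon> n g x \<in> tensor_power n"
  unfolding diagonal_action_def by (rule mult_tensor_power[OF iterated_comult_tensor_power])

lemma diagonal_action_nil: "diagonal_action \<Delta> \<epsilon> 0 g (tens []) = \<epsilon> g *\<^sub>C tens []"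
  by (simp add: diagonal_action_def clinear_scale[OF clinear_mult_left] tensor_mult_tens)

lemma diagonal_action_single: "diagonal_action \<Delta> \<epsilon> (Suc 0) g (tens [x]) = tens [g * x]"
  by (simp add: diagonal_action_def tensor_mult_tens)

lemma diagonal_action_append_single:
  assumes "y \<in> tensor_power n"
  shows "diagonal_action \<Delta> \<epsilon> (Suc n) g (tens [x] \<otimes> y)
    = cop g (\<lambda>a b. tens [a * x] \<otimes> diagonal_action \<Delta> \<epsilon> n b y)"
  unfolding diagonal_action_def iterated_comult_Suc_left
  by (simp add: clinear_cop[OF clinear_mult_left] append_single_mult[OF iterated_comult_tensor_power assms])

text \<open>The degree is tied to the length of the list, so that identities can be proved by
  induction on \<open>hs\<close>.\<close>

definition act :: "'a \<Rightarrow> 'a list \<Rightarrow> 'a tensor" where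
  "act g hs = diagonal_action \<Delta> \<epsilon> (length hs) g (tens hs)"

lemma clinear_act: "clinear f \<Longrightarrow> clinear (\<lambda>x. act (f x) hs)"
  unfolding act_def by (rule clinear_diagonal_action_left)

lemma act_tensor_power: "length hs = n \<Longrightarrow> act g hs \<in> tensor_power n"
  unfolding act_def using diagonal_action_tensor_power tens_in_tensor_power by blast

lemma act_Nil: "act g [] = \<epsilon> g *\<^sub>C tens []"
  by (simp add: act_def diagonal_action_nil)

lemma act_Cons: "act g (h # hs) = cop g (\<lambda>a b. tens [a * h] \<otimes> act b hs)"
  unfolding act_def
  by (simp add: tens_Cons[of h hs] diagonal_action_append_single[OF tens_in_tensor_power])

text \<open>By coassociativity an iterated coproduct can be cut into two blocks; this isolates the
  slot at which a coface or codegeneracy works.\<close>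

lemma act_append: "act g (xs @ ys) = cop g (\<lambda>a b. act a xs \<otimes> act b ys)"
proof (induction xs arbitrary: g)
  case Nil
  show ?case
    by (simp add: act_Nil clinear_scale[OF clinear_append_left] tensor_append_nil cop_counit_left
        clinear_act clinear_ident)
next
  case (Cons x xs)
  have "act g ((x # xs) @ ys) = cop g (\<lambda>a b. cop b (\<lambda>c d. tens [a * x] \<otimes> act c xs \<otimes> act d ys))"
    by (simp add: act_Cons Cons cop_append_right)
  also have "\<dots> = cop g (\<lambda>a b. cop a (\<lambda>c d. tens [c * x] \<otimes> act d xs \<otimes> act b ys))"
    by (rule cop_coassoc[symmetric]) (intro cop_intros clinear_act)+
  also have "\<dots> = cop g (\<lambda>a b. act a (x # xs) \<otimes> act b ys)"
    by (simp add: act_Cons cop_append_left tensor_append_assoc)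
  finally show ?case .
qed

lemma act_one: "act 1 hs = tens hs"
proof (induction hs)
  case Nil
  show ?case by (simp add: act_Nil counit_one scaleC_one)
next
  case (Cons h hs)
  show ?case
    by (simp add: act_Cons cop_one cop_intros clinear_act Cons flip: tens_Cons)
qed

text \<open>The module law, from multiplicativity of \<open>\<Delta>\<close> and
  \<open>\<epsilon>\<close>. The inner result need not be a pure tensor, hence
  \<open>diagonal_action\<close> on the outside.\<close>

lemma diagonal_action_act:
  "length hs = n \<Longrightarrow> diagonal_action \<Delta> \<epsilon> n g (act h hs) = act (g * h) hs"
proof (induction hs arbitrary: n g h)
  case Nil
  then show ?case
    by (simp add: act_Nil clinear_scale[OF clinear_diagonal_action[OF clinear_ident]]
        diagonal_action_nil counit_mult scaleC_scaleC mult.commute)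
next
  case (Cons x xs)
  have "diagonal_action \<Delta> \<epsilon> n g (act h (x # xs))
      = cop h (\<lambda>a b. cop g (\<lambda>c d. tens [c * (a * x)] \<otimes> act (d * b) xs))"
    using Cons(2)[symmetric]
    by (simp add: act_Cons clinear_cop[OF clinear_diagonal_action[OF clinear_ident]]
        diagonal_action_append_single act_tensor_power Cons.IH)
  also have "\<dots> = act (g * h) (x # xs)"
    by (subst cop_swap) (simp add: act_Cons cop_mult cop_intros clinear_act mult.assoc)
  finally show ?case .
qed

lemma diagonal_action_append:
  assumes "x \<in> tensor_power m" "y \<in> tensor_power n"
  shows "diagonal_action \<Delta> \<epsilon> (m + n) g (x \<otimes> y)
    = cop g (\<lambda>a b. diagonal_action \<Delta> \<epsilon> m a x \<otimes> diagonal_action \<Delta> \<epsilon> n b y)"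
proof (rule tensor_power_eqI[OF _ _ assms(1)])
  fix xs :: "'a list" assume xs: "length xs = m"
  show "diagonal_action \<Delta> \<epsilon> (m + n) g (tens xs \<otimes> y)
    = cop g (\<lambda>a b. diagonal_action \<Delta> \<epsilon> m a (tens xs) \<otimes> diagonal_action \<Delta> \<epsilon> n b y)"
  proof (rule tensor_power_eqI[OF _ _ assms(2)])
    fix ys :: "'a list" assume "length ys = n"
    then show "diagonal_action \<Delta> \<epsilon> (m + n) g (tens xs \<otimes> tens ys)
      = cop g (\<lambda>a b. diagonal_action \<Delta> \<epsilon> m a (tens xs) \<otimes> diagonal_action \<Delta> \<epsilon> n b (tens ys))"
      using act_append[of g xs ys] xs by (simp add: act_def tensor_append_tens)
  qed (intro cop_intros clinear_diagonal_action)+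
qed (intro cop_intros clinear_diagonal_action)+

section \<open>Cofaces and codegeneracies\<close>

lemma hopf_d_zero:
  assumes "x \<in> tensor_power n"
  shows "hopf_d \<Delta> n 0 x = tens [1] \<otimes> x"
  by (rule tensor_power_eqI[OF clinear_hopf_d clinear_append_right assms])
    (simp add: hopf_d_tens(1) tensor_append_tens)

text \<open>The blocks around \<open>v\<close> are arbitrary tensors, since they will be of the form
  \<open>act a us\<close>, a sum rather than a pure tensor.\<close>

lemma hopf_d_append:
  assumes "x \<in> tensor_power m" "y \<in> tensor_power n"
  shows "hopf_d \<Delta> (Suc (m + n)) (Suc m) (x \<otimes> tens [v] \<otimes> y) = x \<otimes> \<Delta> v \<otimes> y"
proof (rule tensor_power_eqI[OF _ _ assms(1)])
  fix xs :: "'a list" assume xs: "length xs = m"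
  show "hopf_d \<Delta> (Suc (m + n)) (Suc m) (tens xs \<otimes> tens [v] \<otimes> y) = tens xs \<otimes> \<Delta> v \<otimes> y"
    by (rule tensor_power_eqI[OF _ _ assms(2)])
      (use xs in \<open>auto simp: tensor_append_tens hopf_d_tens nth_append
        intro!: linear_intros clinear_compose[OF clinear_hopf_d]\<close>)
qed (intro linear_intros clinear_compose[OF clinear_hopf_d])+

lemma hopf_s_append:
  assumes "x \<in> tensor_power m" "y \<in> tensor_power n"
  shows "hopf_s \<epsilon> (Suc (m + n)) m (x \<otimes> tens [v] \<otimes> y) = \<epsilon> v *\<^sub>C (x \<otimes> y)"
proof (rule tensor_power_eqI[OF _ _ assms(1)])
  fix xs :: "'a list" assume xs: "length xs = m"
  show "hopf_s \<epsilon> (Suc (m + n)) m (tens xs \<otimes> tens [v] \<otimes> y) = \<epsilon> v *\<^sub>C (tens xs \<otimes> y)"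
    by (rule tensor_power_eqI[OF _ _ assms(2)])
      (use xs in \<open>auto simp: tensor_append_tens hopf_s_tens nth_append
        intro!: linear_intros clinear_compose[OF clinear_hopf_s]\<close>)
qed (intro linear_intros clinear_compose[OF clinear_hopf_s])+

lemma hopf_d_mid:
  assumes "n = Suc (length us + length ws)" "i = Suc (length us)"
  shows "hopf_d \<Delta> n i (tens (us @ v # ws)) = cop v (\<lambda>a b. tens (us @ a # b # ws))"
  using hopf_d_append[OF tens_in_tensor_power[of us] tens_in_tensor_power[of ws], of v] assms
  by (simp add: tensor_append_tens comult_tens_cop)

lemma hopf_s_mid:
  assumes "n = Suc (length us + length ws)" "i = length us"
  shows "hopf_s \<epsilon> n i (tens (us @ v # ws)) = \<epsilon> v *\<^sub>C tens (us @ ws)"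
  using hopf_s_append[OF tens_in_tensor_power[of us] tens_in_tensor_power[of ws], of v] assms
  by (simp add: tensor_append_tens)

lemma act_mid: "act g (us @ v # ws) = cop g (\<lambda>a b. cop b (\<lambda>c d. act a us \<otimes> tens [c * v] \<otimes> act d ws))"
  by (simp add: act_append act_Cons cop_append_right)

text \<open>Multiplicativity splits \<open>\<epsilon> (c * v)\<close>, and the counit axiom then
  absorbs the leg \<open>c\<close>: codegeneracies commute with the diagonal action.\<close>

lemma hopf_s_act:
  assumes "n = Suc (length us + length ws)" "i = length us"
  shows "hopf_s \<epsilon> n i (act g (us @ v # ws)) = \<epsilon> v *\<^sub>C act g (us @ ws)"
proof -
  have "hopf_s \<epsilon> n i (act g (us @ v # ws))
      = cop g (\<lambda>a b. cop b (\<lambda>c d. \<epsilon> c *\<^sub>C \<epsilon> v *\<^sub>C (act a us \<otimes> act d ws)))"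
    by (simp add: act_mid assms clinear_cop[OF clinear_hopf_s] hopf_s_append act_tensor_power
        counit_mult scaleC_scaleC)
  also have "\<dots> = \<epsilon> v *\<^sub>C act g (us @ ws)"
    by (simp add: cop_counit_left cop_intros clinear_act act_append cop_scale del: cvec.scale_scale)
  finally show ?thesis .
qed

text \<open>\<open>\<Delta> (c * v)\<close> multiplies legwise, and by coassociativity the two
  halves of \<open>c\<close> are consecutive legs of \<open>g\<close>; so an inner coface commutes
  with the diagonal action.\<close>

lemma hopf_d_act:
  assumes "n = Suc (length us + length ws)" "i = Suc (length us)"
  shows "hopf_d \<Delta> n i (act g (us @ v # ws)) = cop v (\<lambda>x y. act g (us @ x # y # ws))"
proof -
  have "hopf_d \<Delta> n i (act g (us @ v # ws))
      = cop g (\<lambda>a b. cop b (\<lambda>c d. act a us \<otimes> \<Delta> (c * v) \<otimes> act d ws))"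
    by (simp add: act_mid assms clinear_cop[OF clinear_hopf_d] hopf_d_append act_tensor_power)
  also have "\<dots> = cop g (\<lambda>a b. cop b (\<lambda>c d. cop c (\<lambda>p q. cop v (\<lambda>x y.
      act a us \<otimes> tens [p * x] \<otimes> tens [q * y] \<otimes> act d ws))))"
    by (simp add: comult_cop tens_Cons[of _ "[_]"] cop_mult cop_intros cop_append_left cop_append_right
        tensor_append_assoc)
  also have "\<dots> = cop g (\<lambda>a b. cop b (\<lambda>p r. cop r (\<lambda>q d. cop v (\<lambda>x y.
      act a us \<otimes> tens [p * x] \<otimes> tens [q * y] \<otimes> act d ws))))"
    by (subst cop_coassoc, (intro cop_intros clinear_act)+) (rule refl)
  also have "\<dots> = cop v (\<lambda>x y. act g (us @ x # y # ws))"
    by (simp add: act_append act_Cons cop_append_right cop_swap[where h = v])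
  finally show ?thesis .
qed

lemma hopf_d_first: "length xs = n \<Longrightarrow> hopf_d \<Delta> n 0 (tens xs) = tens (1 # xs)"
  by (rule hopf_d_tens(1))

lemma hopf_d_last: "length xs = n \<Longrightarrow> hopf_d \<Delta> n (Suc n) (tens xs) = tens (xs @ [1])"
  using hopf_d_tens(3)[of xs] by simp

lemma cop_one_mid: "cop 1 (\<lambda>a b. tens (us @ a # b # ws)) = tens (us @ 1 # 1 # ws)"
  by (rule cop_one) (use clinear_tens[of us] clinear_tens[of "us @ [_]"] in simp_all)

section \<open>Degrees of cofaces and codegeneracies\<close>

lemma hopf_d_tensor_power:
  assumes x: "x \<in> tensor_power n" and i: "i \<le> n + 1"
  shows "hopf_d \<Delta> n i x \<in> tensor_power (n + 1)"
proof (rule clinear_tensor_power[OF clinear_hopf_d x])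
  fix xs :: "'a list" assume xs: "length xs = n"
  consider "i = 0" | "i = n + 1" | "i \<noteq> 0" "i - 1 < length xs"
    using i xs by linarith
  then show "hopf_d \<Delta> n i (tens xs) \<in> tensor_power (n + 1)"
  proof cases
    case 1
    then show ?thesis
      using tens_in_tensor_power[of "1 # xs"] xs by (simp add: hopf_d_tens(1))
  next
    case 2
    then show ?thesis
      using tens_in_tensor_power[of "xs @ [1]"] xs hopf_d_tens(3)[OF xs] by simp
  next
    case 3
    then obtain us v ws where xs': "xs = us @ v # ws" "i = Suc (length us)"
      by (metis Suc_pred' list_split_at not_gr0)
    then have "tens (us @ a # b # ws) \<in> tensor_power (n + 1)" for a b
      using xs tens_in_tensor_power[of "us @ a # b # ws"] by simp
    then show ?thesis
      using xs xs' by (simp add: hopf_d_mid cop_tensor_power)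
  qed
qed

lemma hopf_s_tensor_power:
  assumes x: "x \<in> tensor_power (n + 1)" and i: "i \<le> n"
  shows "hopf_s \<epsilon> (n + 1) i x \<in> tensor_power n"
proof (rule clinear_tensor_power[OF clinear_hopf_s x])
  fix xs :: "'a list" assume xs: "length xs = n + 1"
  with i obtain us v ws where xs': "xs = us @ v # ws" "i = length us"
    by (metis Suc_eq_plus1 le_imp_less_Suc list_split_at)
  then show "hopf_s \<epsilon> (n + 1) i (tens xs) \<in> tensor_power n"
    using xs tens_in_tensor_power[of "us @ ws"]
    by (simp add: hopf_s_mid cvec.subspace_scale[OF subspace_tensor_power])
qed

section \<open>The cosimplicial identities\<close>

lemma cop_counit_left_mid: "cop v (\<lambda>a b. \<epsilon> a *\<^sub>C tens (us @ b # ws)) = tens (us @ v # ws)"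
  by (rule cop_counit_left[OF clinear_tens])

lemma cop_counit_right_mid: "cop v (\<lambda>a b. \<epsilon> b *\<^sub>C tens (us @ a # ws)) = tens (us @ v # ws)"
  by (rule cop_counit_right[OF clinear_tens])

lemma cop_coassoc_mid:
  "cop v (\<lambda>a b. cop a (\<lambda>c d. tens (us @ c # d # b # ws)))
    = cop v (\<lambda>a b. cop b (\<lambda>c d. tens (us @ a # c # d # ws)))"
  by (rule cop_coassoc)
    (use clinear_tens[of us] clinear_tens[of "us @ [_]"] clinear_tens[of "us @ [_, _]"] in simp_all)

lemma hopf_s_s:
  assumes x: "x \<in> tensor_power (n + 2)" and ij: "i \<le> j" "j \<le> n"
  shows "hopf_s \<epsilon> (n + 1) j (hopf_s \<epsilon> (n + 2) i x) = hopf_s \<epsilon> (n + 1) i (hopf_s \<epsilon> (n + 2) (j + 1) x)"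
proof (rule tensor_power_eqI[OF _ _ x])
  fix xs :: "'a list" assume xs: "length xs = n + 2"
  with ij have "i < j + 1" "j + 1 < length xs" by simp_all
  then obtain us v ms w ws where xs': "xs = us @ v # ms @ w # ws" "length us = i"
    "Suc (i + length ms) = j + 1"
    by (rule list_split_at2)
  then have n: "n = length us + length ms + length ws" "i = length us" "j = length us + length ms"
    using xs by simp_all
  show "hopf_s \<epsilon> (n + 1) j (hopf_s \<epsilon> (n + 2) i (tens xs))
      = hopf_s \<epsilon> (n + 1) i (hopf_s \<epsilon> (n + 2) (j + 1) (tens xs))"
    unfolding xs'(1) n
    using hopf_s_mid[of _ "us @ v # ms" ws _ w] hopf_s_mid[of _ "us @ ms" ws _ w]
    by (simp add: hopf_s_mid clinear_scale[OF clinear_hopf_s] mult.commute)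
qed (intro clinear_compose[OF clinear_hopf_s] clinear_hopf_s)+

lemma hopf_d_d:
  assumes x: "x \<in> tensor_power n" and ij: "i < j" "j \<le> n + 2"
  shows "hopf_d \<Delta> (n + 1) j (hopf_d \<Delta> n i x) = hopf_d \<Delta> (n + 1) i (hopf_d \<Delta> n (j - 1) x)"
proof (rule tensor_power_eqI[OF _ _ x])
  fix xs :: "'a list" assume xs: "length xs = n"
  note d_simps = clinear_cop[OF clinear_hopf_d] hopf_d_mid hopf_d_first hopf_d_last
  \<comment> \<open>Outer cofaces put a 1 at an end, inner ones double an entry. The cases
    \<open>i = 0\<close>, \<open>j = 1\<close> and \<open>i = n + 1\<close>,
    \<open>j = n + 2\<close> rest on \<open>\<Delta> 1\<close>, and the inner case
    \<open>j = i + 1\<close> on coassociativity; in the others the two operations touch different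
    places.\<close>
  have "i = 0 \<and> j = 1 \<or> i = 0 \<and> 1 < j \<and> j \<le> n + 1 \<or> i = 0 \<and> j = n + 2
    \<or> 0 < i \<and> i \<le> n \<and> j = n + 2 \<or> 0 < i \<and> i = n + 1 \<and> j = n + 2
    \<or> 0 < i \<and> i \<le> n \<and> j = i + 1 \<or> 0 < i \<and> i + 1 < j \<and> j \<le> n + 1"
    using ij by presburger
  then consider "i = 0" "j = 1" | "i = 0" "1 < j" "j \<le> n + 1" | "i = 0" "j = n + 2"
    | "0 < i" "i \<le> n" "j = n + 2" | "0 < i" "i = n + 1" "j = n + 2"
    | "0 < i" "i \<le> n" "j = i + 1" | "0 < i" "i + 1 < j" "j \<le> n + 1"
    by blast
  then show "hopf_d \<Delta> (n + 1) j (hopf_d \<Delta> n i (tens xs)) = hopf_d \<Delta> (n + 1) i (hopf_d \<Delta> n (j - 1) (tens xs))"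
  proof cases
    case 1
    then show ?thesis
      using xs hopf_d_mid[of "Suc n" "[]" xs 1 1] cop_one_mid[of "[]" xs] by (simp add: hopf_d_first)
  next
    case 2
    \<comment> \<open>On the right the coface numbered \<open>j - 1\<close> acts on
      \<open>xs\<close> and doubles the entry of list index \<open>j - 2\<close>.\<close>
    then have "j - 2 < length xs" using xs by simp
    then obtain us v ws where xs': "xs = us @ v # ws" "length us = j - 2"
      by (rule list_split_at)
    then have n: "n = Suc (length us + length ws)" "j = Suc (Suc (length us))"
      using 2 xs by simp_all
    show ?thesis
      unfolding xs'(1) n using 2 hopf_d_mid[of _ "1 # us" ws _ v] by (simp add: d_simps)
  next
    case 3
    then show ?thesis
      using xs by (simp add: hopf_d_first hopf_d_last)
  next
    case 4
    then have "i - 1 < length xs" using xs by simp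
    then obtain us v ws where xs': "xs = us @ v # ws" "length us = i - 1"
      by (rule list_split_at)
    then have n: "n = Suc (length us + length ws)" "i = Suc (length us)"
      using 4 xs by simp_all
    show ?thesis
      unfolding xs'(1) 4(3) n by (simp add: d_simps)
  next
    case 5
    have "hopf_d \<Delta> (Suc n) (Suc n) (tens (xs @ [1])) = tens (xs @ [1, 1])"
      using xs by (simp add: hopf_d_mid cop_one_mid)
    then show ?thesis
      unfolding 5 using xs by (simp add: hopf_d_last)
  next
    case 6
    then have "i - 1 < length xs" using xs by simp
    then obtain us v ws where xs': "xs = us @ v # ws" "length us = i - 1"
      by (rule list_split_at)
    then have n: "n = Suc (length us + length ws)" "i = Suc (length us)"
      using 6 xs by simp_all
    show ?thesis
      unfolding xs'(1) 6(3) n using hopf_d_mid[of _ "us @ [a]" ws for a]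
      by (simp add: d_simps cop_coassoc_mid)
  next
    case 7
    then have "i - 1 < j - 2" "j - 2 < length xs" using xs by simp_all
    then obtain us v ms w ws where xs': "xs = us @ v # ms @ w # ws" "length us = i - 1"
      "Suc (i - 1 + length ms) = j - 2"
      by (rule list_split_at2)
    then have n: "n = Suc (Suc (length us + length ms + length ws))" "i = Suc (length us)"
      "j = Suc (Suc (Suc (length us + length ms)))"
      using 7 xs by simp_all
    show ?thesis
      unfolding xs'(1) n using hopf_d_mid[of _ "us @ a # b # ms" ws for a b] hopf_d_mid[of _ "us @ v # ms" ws]
        cop_swap[of v w "\<lambda>a b c d. tens (us @ a # b # ms @ c # d # ws)"]
      by (simp add: d_simps)
  qed
qed (intro clinear_compose[OF clinear_hopf_d] clinear_hopf_d)+

lemma hopf_s_d_less: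
  assumes x: "x \<in> tensor_power n" and ij: "i < j" "j \<le> n"
  shows "hopf_s \<epsilon> (n + 1) j (hopf_d \<Delta> n i x) = hopf_d \<Delta> (n - 1) i (hopf_s \<epsilon> n (j - 1) x)"
proof (rule tensor_power_eqI[OF _ _ x])
  fix xs :: "'a list" assume xs: "length xs = n"
  show "hopf_s \<epsilon> (n + 1) j (hopf_d \<Delta> n i (tens xs)) = hopf_d \<Delta> (n - 1) i (hopf_s \<epsilon> n (j - 1) (tens xs))"
  proof (cases "i = 0")
    case True
    have "j - 1 < length xs" using xs ij by simp
    then obtain us w ws where xs': "xs = us @ w # ws" "length us = j - 1"
      by (rule list_split_at)
    then have n: "n = Suc (length us + length ws)" "j = Suc (length us)"
      using ij xs by simp_all
    show ?thesis
      unfolding xs'(1) True n using hopf_s_mid[of _ "1 # us" ws _ w]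
      by (simp add: hopf_d_first hopf_s_mid clinear_scale[OF clinear_hopf_d])
  next
    case False
    \<comment> \<open>Doubling shifts the later entries by one, so the entry deleted at index
      \<open>j\<close> afterwards sits at index \<open>j - 1\<close> of \<open>xs\<close>.\<close>
    then have "i - 1 < j - 1" "j - 1 < length xs" using xs ij by simp_all
    then obtain us v ms w ws where xs': "xs = us @ v # ms @ w # ws" "length us = i - 1"
      "Suc (i - 1 + length ms) = j - 1"
      by (rule list_split_at2)
    then have n: "n = Suc (Suc (length us + length ms + length ws))" "i = Suc (length us)"
      "j = Suc (Suc (length us + length ms))"
      using False xs by simp_all
    show ?thesis
      unfolding xs'(1) n
      using hopf_s_mid[of _ "us @ a # b # ms" ws _ w for a b] hopf_s_mid[of _ "us @ v # ms" ws _ w]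
      by (simp add: clinear_cop[OF clinear_hopf_s] hopf_d_mid clinear_scale[OF clinear_hopf_d] cop_scale)
  qed
qed (intro clinear_compose[OF clinear_hopf_d] clinear_hopf_d
    clinear_compose[OF clinear_hopf_s] clinear_hopf_s)+

text \<open>For inner cofaces the two alternatives for \<open>i\<close> are the two counit axioms;
  for the outer ones \<open>\<epsilon> 1 = 1\<close> lets the inserted 1 be deleted.\<close>

lemma hopf_s_d_eq:
  assumes x: "x \<in> tensor_power n" and ij: "j \<le> n" "i = j \<or> i = j + 1"
  shows "hopf_s \<epsilon> (n + 1) j (hopf_d \<Delta> n i x) = x"
proof (rule tensor_power_eqI[OF _ _ x])
  fix xs :: "'a list" assume xs: "length xs = n"
  consider "i = 0" "j = 0" | "i = n + 1" "j = n" | "0 < i" "i \<le> n"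
    using ij by linarith
  then show "hopf_s \<epsilon> (n + 1) j (hopf_d \<Delta> n i (tens xs)) = tens xs"
  proof cases
    case 1
    then show ?thesis
      using xs hopf_s_mid[of "Suc n" "[]" xs 0 1] by (simp add: hopf_d_first counit_one scaleC_one)
  next
    case 2
    have "hopf_s \<epsilon> (Suc n) n (tens (xs @ [1])) = tens xs"
      using xs by (simp add: hopf_s_mid counit_one scaleC_one)
    then show ?thesis
      unfolding 2 using xs by (simp add: hopf_d_last)
  next
    case 3
    then have "i - 1 < length xs" using xs by simp
    then obtain us v ws where xs': "xs = us @ v # ws" "length us = i - 1"
      by (rule list_split_at)
    then have n: "n = Suc (length us + length ws)" "i = Suc (length us)"
      and j: "j = length us \<or> j = Suc (length us)"
      using 3 ij xs by auto
    from j show ?thesis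
      unfolding xs'(1) n using hopf_s_mid[of _ "us @ [a]" ws for a]
      by (auto simp: clinear_cop[OF clinear_hopf_s] hopf_d_mid hopf_s_mid cop_counit_left_mid
          cop_counit_right_mid)
  qed
qed (intro clinear_compose[OF clinear_hopf_s] clinear_hopf_d clinear_ident)+

lemma hopf_s_d_greater:
  assumes x: "x \<in> tensor_power n" and ij: "j + 1 < i" "i \<le> n + 1"
  shows "hopf_s \<epsilon> (n + 1) j (hopf_d \<Delta> n i x) = hopf_d \<Delta> (n - 1) (i - 1) (hopf_s \<epsilon> n j x)"
proof (rule tensor_power_eqI[OF _ _ x])
  fix xs :: "'a list" assume xs: "length xs = n"
  show "hopf_s \<epsilon> (n + 1) j (hopf_d \<Delta> n i (tens xs)) = hopf_d \<Delta> (n - 1) (i - 1) (hopf_s \<epsilon> n j (tens xs))"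
  proof (cases "i = n + 1")
    case True
    have "j < length xs" using xs ij by simp
    then obtain us w ws where xs': "xs = us @ w # ws" "length us = j"
      by (rule list_split_at)
    then have n: "n = Suc (length us + length ws)" "j = length us"
      using ij xs by simp_all
    show ?thesis
      unfolding xs'(1) True n
      by (simp add: hopf_d_last hopf_s_mid clinear_scale[OF clinear_hopf_d])
  next
    case False
    then have "j < i - 1" "i - 1 < length xs" using xs ij by simp_all
    then obtain us v ms w ws where xs': "xs = us @ v # ms @ w # ws" "length us = j"
      "Suc (j + length ms) = i - 1"
      by (rule list_split_at2)
    then have n: "n = Suc (Suc (length us + length ms + length ws))" "j = length us"
      "i = Suc (Suc (length us + length ms))"
      using False xs by simp_all
    show ?thesis
      unfolding xs'(1) n using hopf_d_mid[of _ "us @ v # ms" ws _ w] hopf_d_mid[of _ "us @ ms" ws _ w]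
      by (simp add: clinear_cop[OF clinear_hopf_s] hopf_s_mid clinear_scale[OF clinear_hopf_d] cop_scale)
  qed
qed (intro clinear_compose[OF clinear_hopf_d] clinear_hopf_d
    clinear_compose[OF clinear_hopf_s] clinear_hopf_s)+

end

section \<open>The twisted antipode\<close>

locale hopf_algebra_character = hopf_algebra \<Delta> \<epsilon> S
  for \<Delta> :: "'a::complex_algebra_1 \<Rightarrow> 'a tensor" and \<epsilon> S +
  fixes \<delta> :: "'a \<Rightarrow> complex"
  assumes character: "algebra_character \<delta>"
begin

abbreviation twisted :: "'a \<Rightarrow> 'a" ("S\<^sub>\<delta>") where
  "S\<^sub>\<delta> \<equiv> twisted_antipode \<Delta> S \<delta>"

abbreviation t :: "nat \<Rightarrow> 'a tensor \<Rightarrow> 'a tensor" where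
  "t \<equiv> hopf_t \<Delta> \<epsilon> S \<delta>"

lemma clinear_character: "clinear \<delta>"
  and character_mult: "\<delta> (g * h) = \<delta> g * \<delta> h"
  using character by (simp_all add: algebra_character_def)

text \<open>Cancel a nonzero value \<open>\<delta> h\<close> from
  \<open>\<delta> (h * 1) = \<delta> h * \<delta> 1\<close>.\<close>

lemma character_one: "\<delta> 1 = 1"
proof -
  obtain h where "\<delta> h \<noteq> 0"
    using character by (auto simp: algebra_character_def)
  then show ?thesis
    using character_mult[of h 1] by simp
qed

lemmas twisted_intros = cop_intros clinear_act antipode_linear clinear_compose[OF clinear_character]
  clinear_compose[OF clinear_twisted_antipode[OF character]]

lemma twisted_antipode_cop: "S\<^sub>\<delta> h = cop h (\<lambda>a b. \<delta> a *\<^sub>C S b)"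
  unfolding twisted_antipode_def by (rule sweedler_cop) (intro twisted_intros clinear_character)+

lemma twisted_antipode_one: "S\<^sub>\<delta> 1 = 1"
  by (simp add: twisted_antipode_cop cop_one twisted_intros clinear_character character_one
      antipode_one scaleC_one)

lemma twisted_antipode_mult: "S\<^sub>\<delta> (g * h) = S\<^sub>\<delta> h * S\<^sub>\<delta> g"
proof -
  have "S\<^sub>\<delta> (g * h) = cop g (\<lambda>a b. cop h (\<lambda>c d. (\<delta> c *\<^sub>C S d) * (\<delta> a *\<^sub>C S b)))"
    by (simp add: twisted_antipode_cop cop_mult twisted_intros clinear_character character_mult
        antipode_mult mult_scaleC_left mult_scaleC_right mult.commute)
  also have "\<dots> = S\<^sub>\<delta> h * S\<^sub>\<delta> g"
    by (simp add: twisted_antipode_cop clinear_cop[OF clinear_times_left[OF clinear_ident]]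
        clinear_cop[OF clinear_times_right[OF clinear_ident]] cop_swap[where h = h])
  finally show ?thesis .
qed

text \<open>The antipode flips the legs, and coassociativity gathers the character with its
  neighbouring leg into a twisted antipode; hence only the second output is twisted.\<close>

lemma cop_twisted_antipode:
  assumes f: "\<And>b. clinear (\<lambda>a. f a b)" "\<And>a. clinear (\<lambda>b. f a b)"
  shows "cop (S\<^sub>\<delta> h) f = cop h (\<lambda>a b. f (S b) (S\<^sub>\<delta> a))"
proof -
  have L: "clinear (\<lambda>x. cop x f)"
    by (intro twisted_intros f)
  have "cop (S\<^sub>\<delta> h) f = cop h (\<lambda>a b. cop b (\<lambda>c d. \<delta> a *\<^sub>C f (S d) (S c)))"
    by (simp add: twisted_antipode_cop clinear_cop[OF L] clinear_scale[OF L] cop_antipode f cop_scale)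
  also have "\<dots> = cop h (\<lambda>e d. cop e (\<lambda>a c. \<delta> a *\<^sub>C f (S d) (S c)))"
    by (rule cop_coassoc[symmetric])
      (intro twisted_intros clinear_character clinear_compose[OF f(1)] clinear_compose[OF f(2)])+
  also have "\<dots> = cop h (\<lambda>a b. f (S b) (S\<^sub>\<delta> a))"
    by (simp add: twisted_antipode_cop clinear_cop[OF f(2)] clinear_scale[OF f(2)])
  finally show ?thesis .
qed

text \<open>The key cancellation: the first leg of \<open>S\<^sub>\<delta> a\<close> is a plain
  antipode of the leg next to \<open>b\<close>, so it cancels against \<open>b\<close>, and only
  \<open>1\<close> and \<open>S\<^sub>\<delta> h\<close> remain.\<close>

lemma cop_twisted_antipode_left:
  assumes f: "\<And>b. clinear (\<lambda>a. f a b)" "\<And>a. clinear (\<lambda>b. f a b)"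
  shows "cop h (\<lambda>a b. cop (S\<^sub>\<delta> a) (\<lambda>x y. f (x * b) y)) = f 1 (S\<^sub>\<delta> h)"
proof -
  note f_intros = twisted_intros clinear_compose[OF f(1)] clinear_compose[OF f(2)]
  have "cop h (\<lambda>a b. cop (S\<^sub>\<delta> a) (\<lambda>x y. f (x * b) y))
      = cop h (\<lambda>a b. cop a (\<lambda>c d. f (S d * b) (S\<^sub>\<delta> c)))"
    by (subst cop_twisted_antipode, (intro f_intros f)+) (rule refl)
  also have "\<dots> = cop h (\<lambda>c e. cop e (\<lambda>d b. f (S d * b) (S\<^sub>\<delta> c)))"
    by (rule cop_coassoc) (intro f_intros)+
  also have "\<dots> = cop h (\<lambda>c e. \<epsilon> e *\<^sub>C f 1 (S\<^sub>\<delta> c))"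
    using cop_antipode_left[OF f(1)] by simp
  also have "\<dots> = f 1 (S\<^sub>\<delta> h)"
    by (rule cop_counit_right) (intro f_intros clinear_twisted_antipode[OF character])
  finally show ?thesis .
qed

text \<open>The antipode preserves the counit, so the sum collapses by the counit axiom. Together
  with \<open>character_twisted_antipode\<close> this makes the counit invariant under the square of
  the twisted antipode.\<close>

lemma counit_twisted_antipode: "\<epsilon> (S\<^sub>\<delta> h) = \<delta> h"
  using cop_counit_right[OF clinear_character, of h]
  by (simp add: twisted_antipode_cop clinear_cop[OF counit_linear] clinear_scale[OF counit_linear]
      counit_antipode scaleC_complex_def mult.commute)

text \<open>Multiplicativity turns the sum of \<open>\<delta> a * \<delta> (S b)\<close> into
  \<open>\<delta>\<close> applied to the sum of \<open>a * S b\<close>.\<close>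

lemma character_twisted_antipode: "\<delta> (S\<^sub>\<delta> h) = \<epsilon> h"
  using cop_antipode_right[OF clinear_character, of h]
  by (simp add: twisted_antipode_cop clinear_cop[OF clinear_character] clinear_scale[OF clinear_character]
      character_mult character_one scaleC_complex_def)

section \<open>The cyclic operator\<close>

lemma hopf_t_Cons: "n = Suc (length hs) \<Longrightarrow> t n (tens (h # hs)) = act (S\<^sub>\<delta> h) (hs @ [1])"
  using hopf_t_tens(2)[OF character refl, of hs h] by (simp add: act_def)

text \<open>Once an action has been applied the tail is a sum, so the formula for \<open>t\<close>
  is extended to arbitrary tails \<open>y\<close>.\<close>

lemma hopf_t_append_single:
  assumes "y \<in> tensor_power n"
  shows "t (Suc n) (tens [x] \<otimes> y) = diagonal_action \<Delta> \<epsilon> (Suc n) (S\<^sub>\<delta> x) (y \<otimes> tens [1])"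
  by (rule tensor_power_eqI[OF _ _ assms])
    (auto simp: tensor_append_tens hopf_t_Cons act_def
      intro!: linear_intros clinear_diagonal_action clinear_compose[OF clinear_hopf_t[OF character]])

lemma diagonal_action_mult:
  assumes "y \<in> tensor_power n"
  shows "diagonal_action \<Delta> \<epsilon> n (g * h) y = diagonal_action \<Delta> \<epsilon> n g (diagonal_action \<Delta> \<epsilon> n h y)"
  by (rule tensor_power_eqI[OF _ _ assms])
    (use diagonal_action_act in \<open>auto simp: act_def intro!: clinear_diagonal_action clinear_ident\<close>)

lemma append_one_tensor_power: "y \<in> tensor_power n \<Longrightarrow> y \<otimes> tens [h] \<in> tensor_power (Suc n)"
  using append_tensor_power[OF _ tens_in_tensor_power[of "[h]"]] by simp

text \<open>Antimultiplicativity splits \<open>S\<^sub>\<delta> (a * h)\<close> into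
  \<open>S\<^sub>\<delta> h * S\<^sub>\<delta> a\<close>. The factor
  \<open>S\<^sub>\<delta> h\<close> acts last, and what it acts on collapses to a pure
  tensor.\<close>

lemma hopf_t_act:
  assumes n: "n = Suc (length hs)"
  shows "t n (act (S\<^sub>\<delta> g) (h # hs)) = act (S\<^sub>\<delta> h) (hs @ [S\<^sub>\<delta> (S\<^sub>\<delta> g)])"
proof -
  let ?act = "diagonal_action \<Delta> \<epsilon> n"
  have split: "?act c (act b hs \<otimes> tens [1]) = cop c (\<lambda>x y. act (x * b) hs \<otimes> tens [y])" for b c
    using diagonal_action_append[OF act_tensor_power[OF refl, of b hs] tens_in_tensor_power[of "[1]"], of c]
    by (simp add: n diagonal_action_act diagonal_action_single)
  have "t n (act (S\<^sub>\<delta> g) (h # hs))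
      = cop (S\<^sub>\<delta> g) (\<lambda>a b. ?act (S\<^sub>\<delta> h * S\<^sub>\<delta> a) (act b hs \<otimes> tens [1]))"
    by (simp add: n act_Cons clinear_cop[OF clinear_hopf_t[OF character]] hopf_t_append_single
        act_tensor_power twisted_antipode_mult)
  also have "\<dots> = ?act (S\<^sub>\<delta> h) (cop (S\<^sub>\<delta> g) (\<lambda>a b. ?act (S\<^sub>\<delta> a) (act b hs \<otimes> tens [1])))"
    by (simp add: n diagonal_action_mult append_one_tensor_power act_tensor_power
        clinear_cop[OF clinear_diagonal_action[OF clinear_ident]])
  \<comment> \<open>The key cancellation, taken at \<open>S\<^sub>\<delta> g\<close>: the entries of
    \<open>hs\<close> end up acted on by 1, and the surviving twisted antipode gives the square in
    the last slot.\<close>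
  also have "cop (S\<^sub>\<delta> g) (\<lambda>a b. ?act (S\<^sub>\<delta> a) (act b hs \<otimes> tens [1])) = tens (hs @ [S\<^sub>\<delta> (S\<^sub>\<delta> g)])"
    unfolding split
    by (subst cop_twisted_antipode_left, (intro twisted_intros clinear_ident)+)
      (simp add: act_one tensor_append_tens)
  finally show ?thesis
    by (simp add: n act_def)
qed

text \<open>The tuple \<open>g # hs\<close> of length \<open>n + 1\<close> is the state, and each
  \<open>t\<close> moves its head to the end with the twisted antipode applied twice. Splitting the
  tuple at \<open>y\<close> names the head reached after \<open>length xs\<close> steps.\<close>

lemma hopf_t_funpow_act:
  assumes "g # hs = xs @ y # ys" "n = length hs"
  shows "(t n ^^ length xs) (act (S\<^sub>\<delta> g) hs) = act (S\<^sub>\<delta> y) (ys @ map (S\<^sub>\<delta> \<circ> S\<^sub>\<delta>) xs)"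
  using assms
proof (induction xs arbitrary: g hs ys)
  case Nil
  then show ?case by simp
next
  case (Cons x xs)
  then obtain z zs where hs: "hs = z # zs" "z # zs = xs @ y # ys"
    by (metis append_Cons list.exhaust list.inject append_is_Nil_conv list.distinct(1))
  have "(t n ^^ length (x # xs)) (act (S\<^sub>\<delta> g) hs) = (t n ^^ length xs) (act (S\<^sub>\<delta> z) (zs @ [S\<^sub>\<delta> (S\<^sub>\<delta> g)]))"
    using Cons.prems(2) hs(1) by (simp add: funpow_Suc_right hopf_t_act del: funpow.simps)
  also have "\<dots> = act (S\<^sub>\<delta> y) ((ys @ [S\<^sub>\<delta> (S\<^sub>\<delta> g)]) @ map (S\<^sub>\<delta> \<circ> S\<^sub>\<delta>) xs)"
  proof (rule Cons.IH)
    show "z # zs @ [S\<^sub>\<delta> (S\<^sub>\<delta> g)] = xs @ y # ys @ [S\<^sub>\<delta> (S\<^sub>\<delta> g)]"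
      using hs(2) by (metis append_Cons append_assoc)
    show "n = length (zs @ [S\<^sub>\<delta> (S\<^sub>\<delta> g)])"
      using Cons.prems(2) hs(1) by simp
  qed
  finally show ?case
    using Cons.prems(1) by (simp add: comp_def)
qed

lemma hopf_t_cyclic:
  assumes "length hs = n"
  shows "(t n ^^ (n + 1)) (tens hs) = tens (map (S\<^sub>\<delta> \<circ> S\<^sub>\<delta>) hs)"
proof (cases hs rule: rev_cases)
  case Nil
  then show ?thesis
    using assms by (simp add: hopf_t_tens character)
next
  case (snoc us h)
  \<comment> \<open>The start is \<open>tens hs = act (S\<^sub>\<delta> 1) hs\<close>, a state with
    head 1. \<open>hopf_t_funpow_act\<close> has to leave a head \<open>y\<close> over, so it covers
    \<open>n\<close> steps; the remaining one is \<open>hopf_t_act\<close>, which restores the head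
    1.\<close>
  have "(t n ^^ n) (tens hs) = act (S\<^sub>\<delta> h) (map (S\<^sub>\<delta> \<circ> S\<^sub>\<delta>) (1 # us))"
    using hopf_t_funpow_act[of 1 hs "1 # us" h "[]" n] snoc assms
    by (simp add: twisted_antipode_one act_one del: funpow.simps)
  then show ?thesis
    using snoc assms by (simp add: hopf_t_act twisted_antipode_one act_one)
qed

section \<open>The degree of \<open>t\<close> and its relations with cofaces and
  codegeneracies\<close>

lemma hopf_t_tensor_power:
  assumes "x \<in> tensor_power n"
  shows "t n x \<in> tensor_power n"
proof (rule clinear_tensor_power[OF clinear_hopf_t[OF character] assms])
  fix xs :: "'a list" assume "length xs = n"
  then show "t n (tens xs) \<in> tensor_power n"
    using tens_in_tensor_power[of "[]"]
    by (cases xs) (auto simp: hopf_t_tens(1)[OF character] hopf_t_Cons intro: act_tensor_power)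
qed

lemma hopf_t_d:
  assumes x: "x \<in> tensor_power n" and i: "1 \<le> i" "i \<le> n + 1"
  shows "t (n + 1) (hopf_d \<Delta> n i x) = hopf_d \<Delta> n (i - 1) (t n x)"
proof (rule tensor_power_eqI[OF _ _ x])
  note t_simps = hopf_t_Cons hopf_d_first hopf_d_last hopf_d_mid clinear_cop[OF clinear_hopf_t[OF character]]
  fix xs :: "'a list" assume xs: "length xs = n"
  show "t (n + 1) (hopf_d \<Delta> n i (tens xs)) = hopf_d \<Delta> n (i - 1) (t n (tens xs))"
  proof (cases xs)
    case Nil
    then have "n = 0" "i = 1" using i xs by simp_all
    then show ?thesis
      using Nil hopf_d_last[of "[]" 0]
      by (simp add: t_simps hopf_t_tens(1)[OF character] twisted_antipode_one act_one)
  next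
    case (Cons h hs)
    then have n: "n = Suc (length hs)" using xs by simp
    consider "i = 1" | "i = n + 1" | "1 < i" "i \<le> n"
      using i by linarith
    then show ?thesis
    proof cases
      case 1
      have "hopf_d \<Delta> n i (tens xs) = cop h (\<lambda>a b. tens (a # b # hs))"
        unfolding Cons n 1 using hopf_d_mid[of _ "[]" hs _ h] by simp
      then have "t (n + 1) (hopf_d \<Delta> n i (tens xs)) = cop h (\<lambda>a b. act (S\<^sub>\<delta> a) (b # hs @ [1]))"
        by (simp add: t_simps n)
      \<comment> \<open>The two halves of \<open>h\<close> meet as \<open>S\<^sub>\<delta> a\<close>
        and \<open>b\<close> and cancel in the first slot; the 1 left there is the one inserted by
        the coface numbered 0.\<close>
      also have "\<dots> = tens [1] \<otimes> act (S\<^sub>\<delta> h) (hs @ [1])"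
        unfolding act_Cons by (rule cop_twisted_antipode_left) (intro twisted_intros)+
      also have "\<dots> = hopf_d \<Delta> n (i - 1) (t n (tens xs))"
        using 1 by (simp add: Cons n hopf_t_Cons hopf_d_zero act_tensor_power)
      finally show ?thesis .
    next
      case 2
      have "t (n + 1) (hopf_d \<Delta> n i (tens xs)) = act (S\<^sub>\<delta> h) (hs @ [1, 1])"
        unfolding Cons n 2 by (simp add: t_simps)
      \<comment> \<open>The two final ones are rewritten as \<open>\<Delta> 1\<close>, so that they
        come from the inner coface doubling the 1 that \<open>t\<close> has appended.\<close>
      also have "\<dots> = cop 1 (\<lambda>x y. act (S\<^sub>\<delta> h) (hs @ x # y # []))"
        by (rule cop_one[symmetric]) (simp_all add: act_append act_Cons twisted_intros)
      also have "\<dots> = hopf_d \<Delta> n (i - 1) (t n (tens xs))"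
        unfolding Cons 2 using n by (simp add: hopf_t_Cons hopf_d_act)
      finally show ?thesis .
    next
      case 3
      then have "i - 2 < length hs" using n by simp
      then obtain us v ws where hs: "hs = us @ v # ws" "length us = i - 2"
        by (rule list_split_at)
      then have n': "n = Suc (Suc (length us + length ws))" "i = Suc (Suc (length us))"
        using 3 n by simp_all
      show ?thesis
        unfolding Cons hs(1) n' using hopf_d_mid[of _ "h # us" ws _ v] by (simp add: t_simps hopf_d_act)
    qed
  qed
qed (intro clinear_compose[OF clinear_hopf_d] clinear_hopf_d
    clinear_compose[OF clinear_hopf_t[OF character]] clinear_hopf_t[OF character])+

lemma hopf_t_d_0:
  assumes "x \<in> tensor_power n"
  shows "t (n + 1) (hopf_d \<Delta> n 0 x) = hopf_d \<Delta> n (n + 1) x"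
  by (rule tensor_power_eqI[OF _ _ assms])
    (auto simp: hopf_d_first hopf_d_last hopf_t_Cons twisted_antipode_one act_one
      intro!: clinear_hopf_d clinear_compose[OF clinear_hopf_t[OF character]])

lemma hopf_t_s:
  assumes x: "x \<in> tensor_power (n + 1)" and i: "1 \<le> i" "i \<le> n"
  shows "t n (hopf_s \<epsilon> (n + 1) i x) = hopf_s \<epsilon> (n + 1) (i - 1) (t (n + 1) x)"
proof (rule tensor_power_eqI[OF _ _ x])
  fix xs :: "'a list" assume xs: "length xs = n + 1"
  then obtain h hs where Cons: "xs = h # hs" "length hs = n" by (cases xs) auto
  then have "i - 1 < length hs" using i by simp
  then obtain us v ws where hs: "hs = us @ v # ws" "length us = i - 1"
    by (rule list_split_at)
  then have n: "n = Suc (length us + length ws)" "i = Suc (length us)"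
    using i Cons by simp_all
  show "t n (hopf_s \<epsilon> (n + 1) i (tens xs)) = hopf_s \<epsilon> (n + 1) (i - 1) (t (n + 1) (tens xs))"
    unfolding Cons hs(1) n using hopf_s_mid[of _ "h # us" ws _ v]
    by (simp add: hopf_t_Cons hopf_s_act clinear_scale[OF clinear_hopf_t[OF character]])
qed (intro clinear_compose[OF clinear_hopf_s] clinear_hopf_s
    clinear_compose[OF clinear_hopf_t[OF character]] clinear_hopf_t[OF character])+

text \<open>After two applications of \<open>t\<close> the entry to be deleted comes from the
  twisted antipode applied twice to \<open>h\<close>; the counit does not see this square.\<close>

lemma hopf_t_s_0:
  assumes x: "x \<in> tensor_power (n + 1)"
  shows "t n (hopf_s \<epsilon> (n + 1) 0 x) = hopf_s \<epsilon> (n + 1) n (t (n + 1) (t (n + 1) x))"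
proof (rule tensor_power_eqI[OF _ _ x])
  fix xs :: "'a list" assume xs: "length xs = n + 1"
  then obtain h hs where Cons: "xs = h # hs" "n = length hs" by (cases xs) auto
  have "\<epsilon> (S\<^sub>\<delta> (S\<^sub>\<delta> h)) = \<epsilon> h"
    by (simp add: counit_twisted_antipode character_twisted_antipode)
  then have s: "hopf_s \<epsilon> (Suc (length us)) (length us) (act g (us @ [S\<^sub>\<delta> (S\<^sub>\<delta> h)])) = \<epsilon> h *\<^sub>C act g us"
    for g us
    using hopf_s_act[of _ us "[]" _ g] by simp
  have left: "hopf_s \<epsilon> (n + 1) 0 (tens xs) = \<epsilon> h *\<^sub>C tens hs"
    unfolding Cons using hopf_s_mid[of _ "[]" hs _ h] by simp
  show "t n (hopf_s \<epsilon> (n + 1) 0 (tens xs)) = hopf_s \<epsilon> (n + 1) n (t (n + 1) (t (n + 1) (tens xs)))"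
  proof (cases hs)
    case Nil
    \<comment> \<open>Here \<open>n = 0\<close>, where \<open>t\<close> on the left is the identity
      by definition; on the right the second \<open>t\<close> meets the head 1.\<close>
    have "t 1 (t 1 (tens [h])) = act 1 [S\<^sub>\<delta> (S\<^sub>\<delta> h)]"
      using hopf_t_act[of 1 "[]" h 1] by (simp add: hopf_t_Cons twisted_antipode_one)
    moreover have "n = 0"
      using Nil Cons by simp
    ultimately show ?thesis
      unfolding left using Nil Cons s[of "[]" 1]
      by (simp add: act_one clinear_scale[OF clinear_hopf_t[OF character]] hopf_t_tens(1)[OF character])
  next
    case (Cons g gs)
    have "t (n + 1) (t (n + 1) (tens xs)) = act (S\<^sub>\<delta> g) ((gs @ [1]) @ [S\<^sub>\<delta> (S\<^sub>\<delta> h)])"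
      unfolding \<open>xs = h # hs\<close> \<open>n = length hs\<close> Cons by (simp add: hopf_t_Cons hopf_t_act)
    moreover have "n = length (gs @ [1])"
      using \<open>n = length hs\<close> Cons by simp
    ultimately show ?thesis
      unfolding left using s[of "gs @ [1]"] Cons
      by (simp add: hopf_t_Cons clinear_scale[OF clinear_hopf_t[OF character]])
  qed
qed (intro clinear_compose[OF clinear_hopf_s] clinear_hopf_s
    clinear_compose[OF clinear_hopf_t[OF character]] clinear_hopf_t[OF character])+

section \<open>The equivalence\<close>

lemma cyclic_module_iff:
  "cyclic_module tensor_power (hopf_d \<Delta>) (hopf_s \<epsilon>) t \<longleftrightarrow> S\<^sub>\<delta> \<circ> S\<^sub>\<delta> = id"
proof
  assume cyclic: "cyclic_module tensor_power (hopf_d \<Delta>) (hopf_s \<epsilon>) t"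
  have "tens [S\<^sub>\<delta> (S\<^sub>\<delta> h)] = tens [h]" for h
    using hopf_t_cyclic[of "[h]" 1] cyclic_module.t_cyclic[OF cyclic tens_in_tensor_power[of "[h]"]]
    by simp
  then show "S\<^sub>\<delta> \<circ> S\<^sub>\<delta> = id"
    by (simp add: fun_eq_iff tens_single_inject)
next
  assume id: "S\<^sub>\<delta> \<circ> S\<^sub>\<delta> = id"
  have between: "linear_map_between (tensor_power m) (tensor_power n) f"
    if "clinear f" "\<And>x. x \<in> tensor_power m \<Longrightarrow> f x \<in> tensor_power n"
    for m n and f :: "'a tensor \<Rightarrow> 'a tensor"
    using that by (simp add: linear_map_between_def clinear_add clinear_scale)
  \<comment> \<open>The place where \<open>id\<close> enters: the power of \<open>t\<close> becomes
    the identity on pure tensors, and linearity extends this to the whole degree.\<close>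
  have cyclic: "(t n ^^ (n + 1)) x = x" if "x \<in> tensor_power n" for n x
  proof (rule tensor_power_eqI[OF _ clinear_ident that])
    have "clinear (\<lambda>x. (t n ^^ k) x)" for k
      by (induction k) (simp_all add: clinear_ident clinear_compose[OF clinear_hopf_t[OF character]])
    then show "clinear (t n ^^ (n + 1))" .
    show "(t n ^^ (n + 1)) (tens xs) = tens xs" if "length xs = n" for xs
      unfolding hopf_t_cyclic[OF that] id by simp
  qed
  show "cyclic_module tensor_power (hopf_d \<Delta>) (hopf_s \<epsilon>) t"
    by (rule cyclic_module.intro;
        (assumption | rule subspace_tensor_power between clinear_hopf_d clinear_hopf_s
          clinear_hopf_t[OF character] hopf_d_tensor_power hopf_s_tensor_power hopf_t_tensor_power
          hopf_d_d hopf_s_s hopf_s_d_less hopf_s_d_eq hopf_s_d_greater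
          hopf_t_d hopf_t_d_0 hopf_t_s hopf_t_s_0 cyclic)+)
qed

end

theorem proposition4p4:
  fixes \<Delta> :: "'h::complex_algebra_1 \<Rightarrow> 'h tensor"
    and \<epsilon> :: "'h \<Rightarrow> complex"
    and S :: "'h \<Rightarrow> 'h"
    and \<delta> :: "'h \<Rightarrow> complex"
  assumes "hopf_algebra \<Delta> \<epsilon> S"
    and "algebra_character \<delta>"
  shows "(cyclic_module tensor_power (hopf_d \<Delta>) (hopf_s \<epsilon>) (hopf_t \<Delta> \<epsilon> S \<delta>)
           \<longleftrightarrow> twisted_antipode \<Delta> S \<delta> \<circ> twisted_antipode \<Delta> S \<delta> = id)
       \<and> (\<forall>n hs. length hs = n \<longrightarrow>
            (hopf_t \<Delta> \<epsilon> S \<delta> n ^^ (n + 1)) (tens hs)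
              = tens (map (twisted_antipode \<Delta> S \<delta> \<circ> twisted_antipode \<Delta> S \<delta>) hs))"
proof -
  interpret hopf_algebra_character \<Delta> \<epsilon> S \<delta>
    using assms by (simp add: hopf_algebra_character_def hopf_algebra_character_axioms_def)
  show ?thesis
    using cyclic_module_iff hopf_t_cyclic by blast
qed

end
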